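(* Let $N\ge3$ be odd, $\alpha>0$, and let $L=\Delta^{\mathrm{ad}}_\alpha$. For $k\in Z_N^+$ and $E_k\in\{X_k,Y_k\}$, the Ricci curvature of the left-invariant Zeitlin metric $\langle\cdot,\cdot\rangle^L$ with respect to the rescaled Lie bracket $[\cdot,\cdot]_\alpha=\alpha[\cdot,\cdot]$ on $\mathfrak{su}(N)$ satisfies $$(N^2-1)\mathrm{Ric}(E_k,E_k)=\sum_{E_i}\left(\frac{\langle\nabla_{E_i}E_k,\nabla_{E_k}E_i\rangle^L}{\langle E_i,E_i\rangle^L}+\frac12\frac{\langle[E_i,E_k]_\alpha,[E_k,E_i]_\alpha\rangle^L}{\langle E_i,E_i\rangle^L}+\frac12\frac{\langle[E_i,E_k]_\alpha,\mathrm{ad}^\star_{E_k}E_i\rangle^L}{\langle E_i,E_i\rangle^L}-\frac12\frac{\langle[E_i,E_k]_\alpha,\mathrm{ad}^\star_{E_i}E_k\rangle^L}{\langle E_i,E_i\rangle^L}\right)$$ $$=\alpha^2\sum_{i\in Z_N^+}c_{ik}^2\,\frac{-3(\lambda^\alpha_{k+i}+\lambda^\alpha_{k-i})+(\lambda^\alpha_i-\lambda^\alpha_k)^2\left((\lambda^\alpha_{k+i})^{-1}+(\lambda^\alpha_{k-i})^{-1}\right)+4(\lambda^\alpha_k+\lambda^\alpha_i)}{8\lambda^\alpha_i},$$ where $c_{ik}=\frac N\pi\sin\left(\frac\pi N\,i\times k\right)$, $E_i$ runs through the basis $\{X_i,Y_i\}_{i\in Z_N^+}$, and $\lambda^\alpha_p=-\left(\frac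 N\pi\right)^2\left(\alpha^2\sin^2\left(\frac{\pi p_1}{N}\right)+\sin^2\left(\frac{\pi p_2}{N}\right)\right)$.
   Context: Let $N=2M+1$ be odd, $M\ge1$, $Z_N=\{-M,\dots,M\}^2\setminus\{(0,0)\}$, and $Z_N^+=\{k\in Z_N: k_2>0\}\cup\{k\in Z_N:k_1>0,\ k_2=0\}$. Write $p\times q=p_1q_2-p_2q_1$. Put $\omega=e^{2\pi i/N}$, $\omega^{1/2}=e^{\pi i/N}$, $U=\mathrm{diag}(1,\omega,\dots,\omega^{N-1})$, and let $V$ be the $N\times N$ cyclic shift matrix with $V_{j,j+1}=1$ for $1\le j\le N-1$, $V_{N,1}=1$, all other entries $0$. For $k\in\mathbb Z^2$ put $T_k=-\frac{iN}{2\pi}\omega^{k_1k_2/2}U^{k_1}V^{k_2}$, $X_k=\frac12(T_k+T_{-k})$, $Y_k=\frac1{2i}(T_k-T_{-k})$ (here $i=\sqrt{-1}$). The family $\{X_k,Y_k\}_{k\in Z_N^+}$ is a real basis of $\mathfrak{su}(N)$. The adjoint $\alpha$-Laplacian is $\Delta^{\mathrm{ad}}_\alpha w=\alpha^2[T_{0,-1},[T_{0,1},w]]+[T_{-1,0},[T_{1,0},w]]$ (ordinary matrix commutators); $X_k,Y_k$ are eigenvectors with eigenvalue $\lambda_k^\alpha$. The metric is the left-invariant one given on $\mathfrak{su}(N)$ by $\langle u,v\rangle^L=-\hbar_N\mathrm{Tr}(u^\dagger Lv)$ with $\hbar_N=2^4\pi^4/N^3$. All geometric quantities are those of the left-invariant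 metric on the Lie group whose Lie algebra is $\mathfrak{su}(N)$ with bracket $[\cdot,\cdot]_\alpha$: $\langle\mathrm{ad}^\star_XY,Z\rangle^L=\langle Y,[X,Z]_\alpha\rangle^L$; the Levi-Civita connection is $2\nabla_XY=[X,Y]_\alpha-\mathrm{ad}^\star_XY-\mathrm{ad}^\star_YX$; $R(X,Y)Z=\nabla_X\nabla_YZ-\nabla_Y\nabla_XZ-\nabla_{[X,Y]_\alpha}Z$; and $\mathrm{Ric}(E,F)=\frac1{N^2-1}\sum_{E_i}\langle R(E_i,E)F,E_i\rangle^L/\langle E_i,E_i\rangle^L$, with $E_i$ running through $\{X_i,Y_i\}_{i\in Z_N^+}$. Terms containing $(\lambda^\alpha_{(0,0)})^{-1}$ (which occur only for $i=k$) are multiplied by $c_{ik}=0$ and are interpreted as $0$. *)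

theory Defs
  imports
    Complex_Main
    "HOL-Library.Product_Plus"
    "Jordan_Normal_Form.Schur_Decomposition"
    "Jordan_Normal_Form.Gauss_Jordan_Elimination"
begin

definition mat_trace :: "complex mat \<Rightarrow> complex" where
  "mat_trace A = (\<Sum>i<dim_row A. A $$ (i, i))"

text \<open>Meaningful only for invertible \<open>A\<close>; otherwise \<open>the (mat_inverse A)\<close> is unspecified.\<close>

definition mat_powi :: "complex mat \<Rightarrow> int \<Rightarrow> complex mat" where
  "mat_powi A n = (if n \<ge> 0 then A ^\<^sub>m nat n else the (mat_inverse A) ^\<^sub>m nat (- n))"

definition su :: "nat \<Rightarrow> complex mat set" where
  "su N = {A \<in> carrier_mat N N. mat_adjoint A = - A \<and> mat_trace A = 0}"

definition commutator :: "complex mat \<Rightarrow> complex mat \<Rightarrow> complex mat" where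
  "commutator A B = A * B - B * A"

text \<open>For odd \<open>N = 2 M + 1\<close> we have \<open>M = N div 2\<close>.\<close>

definition Z_index :: "nat \<Rightarrow> (int \<times> int) set" where
  "Z_index N = {- int (N div 2)..int (N div 2)} \<times> {- int (N div 2)..int (N div 2)} - {(0, 0)}"

definition Z_plus :: "nat \<Rightarrow> (int \<times> int) set" where
  "Z_plus N = {k \<in> Z_index N. snd k > 0} \<union> {k \<in> Z_index N. fst k > 0 \<and> snd k = 0}"

definition cross :: "int \<times> int \<Rightarrow> int \<times> int \<Rightarrow> int" where
  "cross p q = fst p * snd q - snd p * fst q"

definition omega :: "nat \<Rightarrow> complex" where
  "omega N = exp (2 * of_real pi * \<i> / of_nat N)"

definition omega_half :: "nat \<Rightarrow> complex" where
  "omega_half N = exp (of_real pi * \<i> / of_nat N)"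

text \<open>Rows and columns are numbered from \<open>0\<close>, so the entries \<open>V\<^bsub>j,j+1\<^esub> = 1\<close> for
  \<open>1 \<le> j \<le> N - 1\<close> and \<open>V\<^bsub>N,1\<^esub> = 1\<close> become the single condition \<open>j = (i + 1) mod N\<close>.\<close>

definition clock_mat :: "nat \<Rightarrow> complex mat" where
  "clock_mat N = mat_diag N (\<lambda>j. omega N ^ j)"

definition shift_mat :: "nat \<Rightarrow> complex mat" where
  "shift_mat N = mat N N (\<lambda>(i, j). if j = (i + 1) mod N then 1 else 0)"

definition T :: "nat \<Rightarrow> int \<times> int \<Rightarrow> complex mat" where
  "T N k = (- (\<i> * of_nat N / (2 * of_real pi)) * omega_half N powi (fst k * snd k)) \<cdot>\<^sub>m
     (mat_powi (clock_mat N) (fst k) * mat_powi (shift_mat N) (snd k))"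

definition X :: "nat \<Rightarrow> int \<times> int \<Rightarrow> complex mat" where
  "X N k = (1 / 2) \<cdot>\<^sub>m (T N k + T N (- k))"

definition Y :: "nat \<Rightarrow> int \<times> int \<Rightarrow> complex mat" where
  "Y N k = (1 / (2 * \<i>)) \<cdot>\<^sub>m (T N k - T N (- k))"

definition basis_sum :: "nat \<Rightarrow> (complex mat \<Rightarrow> complex) \<Rightarrow> complex" where
  "basis_sum N f = (\<Sum>i\<in>Z_plus N. f (X N i) + f (Y N i))"

definition adj_laplacian :: "nat \<Rightarrow> real \<Rightarrow> complex mat \<Rightarrow> complex mat" where
  "adj_laplacian N \<alpha> w =
     of_real (\<alpha>\<^sup>2) \<cdot>\<^sub>m commutator (T N (0, - 1)) (commutator (T N (0, 1)) w)
     + commutator (T N (- 1, 0)) (commutator (T N (1, 0)) w)"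

definition hbar :: "nat \<Rightarrow> real" where
  "hbar N = 2 ^ 4 * pi ^ 4 / real N ^ 3"

text \<open>The trace formula is kept complex-valued instead of taking real parts; on \<open>su N\<close> its
  values are real.\<close>

definition metric :: "nat \<Rightarrow> real \<Rightarrow> complex mat \<Rightarrow> complex mat \<Rightarrow> complex" where
  "metric N \<alpha> u v = - of_real (hbar N) * mat_trace (mat_adjoint u * adj_laplacian N \<alpha> v)"

definition bracket :: "real \<Rightarrow> complex mat \<Rightarrow> complex mat \<Rightarrow> complex mat" where
  "bracket \<alpha> A B = of_real \<alpha> \<cdot>\<^sub>m commutator A B"

text \<open>For \<open>\<alpha> \<noteq> 0\<close> and odd \<open>N\<close> the metric is positive definite on \<open>su N\<close>, so \<open>THE\<close> picks a unique element.\<close>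

definition ad_star :: "nat \<Rightarrow> real \<Rightarrow> complex mat \<Rightarrow> complex mat \<Rightarrow> complex mat" where
  "ad_star N \<alpha> A B = (THE W. W \<in> su N \<and>
     (\<forall>C\<in>su N. metric N \<alpha> W C = metric N \<alpha> B (bracket \<alpha> A C)))"

definition nabla :: "nat \<Rightarrow> real \<Rightarrow> complex mat \<Rightarrow> complex mat \<Rightarrow> complex mat" where
  "nabla N \<alpha> A B = (1 / 2) \<cdot>\<^sub>m (bracket \<alpha> A B - ad_star N \<alpha> A B - ad_star N \<alpha> B A)"

definition riemann ::
  "nat \<Rightarrow> real \<Rightarrow> complex mat \<Rightarrow> complex mat \<Rightarrow> complex mat \<Rightarrow> complex mat" where
  "riemann N \<alpha> A B C =
     nabla N \<alpha> A (nabla N \<alpha> B C) - nabla N \<alpha> B (nabla N \<alpha> A C) - nabla N \<alpha> (bracket \<alpha> A B) C"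

definition ricci :: "nat \<Rightarrow> real \<Rightarrow> complex mat \<Rightarrow> complex mat \<Rightarrow> complex" where
  "ricci N \<alpha> E F = 1 / (of_nat N ^ 2 - 1) *
     basis_sum N (\<lambda>Ei. metric N \<alpha> (riemann N \<alpha> Ei E F) Ei / metric N \<alpha> Ei Ei)"

text \<open>\<open>eigval N \<alpha> (0, 0) = 0\<close>, so its \<open>inverse\<close> is \<open>0\<close> in HOL.  This agrees with reading terms
  with \<open>inverse (eigval N \<alpha> (0, 0))\<close> as \<open>0\<close>.\<close>

definition eigval :: "nat \<Rightarrow> real \<Rightarrow> int \<times> int \<Rightarrow> real" where
  "eigval N \<alpha> p = - (real N / pi)\<^sup>2 *
     (\<alpha>\<^sup>2 * (sin (pi * of_int (fst p) / real N))\<^sup>2 + (sin (pi * of_int (snd p) / real N))\<^sup>2)"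

definition struct_const :: "nat \<Rightarrow> int \<times> int \<Rightarrow> int \<times> int \<Rightarrow> real" where
  "struct_const N i k = real N / pi * sin (pi / real N * of_int (cross i k))"

end

theory Submission
  imports Defs
begin

text \<open>
  Every basis vector is a wave \<open>x T\<^bsub>p\<^esub> + cnj x T\<^bsub>-p\<^esub>\<close> with \<open>\<bar>x\<bar> = 1/2\<close>. A wave is an eigenvector of
  the Laplacian \<open>L\<close>, and the bracket of waves at \<open>p\<close> and \<open>q\<close> is a wave at \<open>p + q\<close> plus a wave at
  \<open>p - q\<close>, so the real span of the waves at indices nonzero modulo \<open>N\<close> is closed under all the
  operations involved. On this span \<open>ad\<^sup>\<star>\<^bsub>A\<^esub> B = L\<inverse> [L B, A]\<^bsub>\<alpha>\<^esub>\<close>. The first equality follows from the Koszul formula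
  and \<open>\<nabla>\<^bsub>F\<^esub> F = 0\<close>. For the second one, write \<open>[E, F]\<^bsub>\<alpha>\<^esub> = P + Q\<close> with orthogonal waves \<open>P, Q\<close> and
  express every term through \<open>P + Q\<close> and \<open>L\<inverse> (P + Q)\<close>; the contributions of \<open>X\<^bsub>i\<^esub>\<close> and \<open>Y\<^bsub>i\<^esub>\<close> coincide.
\<close>

section \<open>Matrix algebra: inverses, adjoints, traces, commutators and the Lie algebra
  \<open>su n\<close>\<close>

lemma mat_inverse_eqI:
  fixes A :: "complex mat"
  assumes A: "A \<in> carrier_mat n n" and B: "B \<in> carrier_mat n n"
    and AB: "A * B = 1\<^sub>m n" and BA: "B * A = 1\<^sub>m n"
  shows "mat_inverse A = Some B"
proof (cases "mat_inverse A")
  case None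
  have "A \<in> Units (ring_mat TYPE(complex) n ())"
    using A B AB BA by (auto simp: Units_def ring_mat_def)
  then show ?thesis using mat_inverse(1)[OF A None, where b = "()"] by blast
next
  case (Some C)
  then have C: "A * C = 1\<^sub>m n" "C \<in> carrier_mat n n"
    using mat_inverse(2)[OF A] by auto
  have "B = B * (A * C)" using B C by simp
  also have "\<dots> = (B * A) * C" using A B C by simp
  finally show ?thesis using Some BA C by simp
qed

lemma omega_half_nz [simp]: "omega_half N \<noteq> 0"
  by (simp add: omega_half_def)

lemma powi_omega_half: "omega_half N powi m = cis (pi * of_int m / N)"
proof -
  have "omega_half N = cis (pi / N)"
    by (simp add: omega_half_def cis_conv_exp mult.commute)
  then show ?thesis by (simp add: cis_power_int mult.commute)
qed

lemma omega_eq: "omega N = omega_half N powi 2"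
  unfolding omega_def powi_omega_half cis_conv_exp by (simp add: mult_ac)

lemma mat_adjoint_index:
  fixes A :: "complex mat"
  assumes "A \<in> carrier_mat n m" "i < m" "j < n"
  shows "mat_adjoint A $$ (i, j) = cnj (A $$ (j, i))"
  using assms by (simp add: mat_adjoint_def mat_of_rows_def)

lemma mat_adjoint_carrier: "A \<in> carrier_mat n m \<Longrightarrow> mat_adjoint A \<in> carrier_mat m n"
  by (auto simp: mat_adjoint_def)

context
  fixes n :: nat
begin

lemmas mat_arith =
  add_mult_distrib_mat[of _ n n _ _ n] mult_add_distrib_mat[of _ n n _ n]
  minus_mult_distrib_mat[of _ n n _ _ n] mult_minus_distrib_mat[of _ n n _ n]
  mult_smult_assoc_mat[of _ n n _ n] mult_smult_distrib[of _ n n _ n]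
  minus_carrier_mat[of _ n n] mult_carrier_mat[of _ n n _ n] assoc_mult_mat[of _ n n _ n _ n]

lemma mat_trace_add:
  "A \<in> carrier_mat n n \<Longrightarrow> B \<in> carrier_mat n n \<Longrightarrow> mat_trace (A + B) = mat_trace A + mat_trace B"
  by (auto simp: mat_trace_def sum.distrib)

lemma mat_trace_diff:
  "A \<in> carrier_mat n n \<Longrightarrow> B \<in> carrier_mat n n \<Longrightarrow> mat_trace (A - B) = mat_trace A - mat_trace B"
  by (auto simp: mat_trace_def sum_subtractf)

lemma mat_trace_smult: "A \<in> carrier_mat n n \<Longrightarrow> mat_trace (c \<cdot>\<^sub>m A) = c * mat_trace A"
  by (auto simp: mat_trace_def sum_distrib_left)

lemma mat_trace_mult_commute:
  assumes "A \<in> carrier_mat n n" "B \<in> carrier_mat n n"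
  shows "mat_trace (A * B) = mat_trace (B * A)"
proof -
  have "mat_trace (A * B) = (\<Sum>i\<in>{0..<n}. \<Sum>j\<in>{0..<n}. A $$ (i, j) * B $$ (j, i))"
    using assms by (simp add: mat_trace_def scalar_prod_def atLeast0LessThan)
  also have "\<dots> = (\<Sum>j\<in>{0..<n}. \<Sum>i\<in>{0..<n}. B $$ (j, i) * A $$ (i, j))"
    by (subst sum.swap) (simp add: mult.commute)
  also have "\<dots> = mat_trace (B * A)"
    using assms by (simp add: mat_trace_def scalar_prod_def atLeast0LessThan)
  finally show ?thesis .
qed

lemma commutator_carrier [simp]:
  "A \<in> carrier_mat n n \<Longrightarrow> B \<in> carrier_mat n n \<Longrightarrow> commutator A B \<in> carrier_mat n n"
  by (simp add: commutator_def mat_arith)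

lemma commutator_dim [simp]:
  "dim_row (commutator A B) = dim_row B" "dim_col (commutator A B) = dim_col A"
  by (simp_all add: commutator_def)

lemma commutator_add_left:
  "A \<in> carrier_mat n n \<Longrightarrow> B \<in> carrier_mat n n \<Longrightarrow> C \<in> carrier_mat n n \<Longrightarrow>
   commutator (A + B) C = commutator A C + commutator B C"
  unfolding commutator_def
  by (simp add: mat_arith, intro eq_matI) auto

lemma commutator_add_right:
  "A \<in> carrier_mat n n \<Longrightarrow> B \<in> carrier_mat n n \<Longrightarrow> C \<in> carrier_mat n n \<Longrightarrow>
   commutator C (A + B) = commutator C A + commutator C B"
  unfolding commutator_def
  by (simp add: mat_arith, intro eq_matI) auto

lemma commutator_smult_left:
  "A \<in> carrier_mat n n \<Longrightarrow> C \<in> carrier_mat n n \<Longrightarrow>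
   commutator (c \<cdot>\<^sub>m A) C = c \<cdot>\<^sub>m commutator A C"
  unfolding commutator_def
  by (simp add: mat_arith, intro eq_matI)
    (auto simp: right_diff_distrib)

lemma commutator_smult_right:
  "A \<in> carrier_mat n n \<Longrightarrow> C \<in> carrier_mat n n \<Longrightarrow>
   commutator C (c \<cdot>\<^sub>m A) = c \<cdot>\<^sub>m commutator C A"
  unfolding commutator_def
  by (simp add: mat_arith, intro eq_matI)
    (auto simp: right_diff_distrib)

lemma commutator_swap:
  "A \<in> carrier_mat n n \<Longrightarrow> B \<in> carrier_mat n n \<Longrightarrow> commutator B A = - commutator A B"
  unfolding commutator_def by (intro eq_matI) auto

text \<open>Invariance of the trace form: after expanding, the two sides differ only in one term,
  and cyclicity of the trace turns \<open>A * C * B\<close> into \<open>B * A * C\<close>.\<close>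

lemma trace_mult_commutator:
  assumes "A \<in> carrier_mat n n" "B \<in> carrier_mat n n" "C \<in> carrier_mat n n"
  shows "mat_trace (A * commutator B C) = mat_trace (commutator A B * C)"
proof -
  have "mat_trace (A * commutator B C) = mat_trace (A * (B * C)) - mat_trace ((A * C) * B)"
    using assms unfolding commutator_def
    by (simp add: mat_arith mat_trace_diff)
  also have "mat_trace ((A * C) * B) = mat_trace (B * (A * C))"
    using assms by (intro mat_trace_mult_commute) auto
  also have "mat_trace (A * (B * C)) - mat_trace (B * (A * C)) = mat_trace (commutator A B * C)"
    using assms unfolding commutator_def
    by (simp add: mat_arith mat_trace_diff
        mat_arith)
  finally show ?thesis .
qed

text \<open>The Jacobi identity in the case where the commutator of \<open>S\<close> and
  \<open>R\<close> vanishes.\<close>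

lemma commutator_commute:
  assumes "A \<in> carrier_mat n n" "S \<in> carrier_mat n n" "R \<in> carrier_mat n n" "S * R = R * S"
  shows "commutator S (commutator R A) = commutator R (commutator S A)"
proof -
  have mix: "(P1 - P2) - (P3 - P4) = (P1 - P3) - (P2 - P4)"
    if "P1 \<in> carrier_mat n n" "P2 \<in> carrier_mat n n" "P3 \<in> carrier_mat n n" "P4 \<in> carrier_mat n n"
    for P1 P2 P3 P4 :: "complex mat"
    using that by (intro eq_matI) auto
  have "commutator S (commutator R A) = (S * R * A - S * A * R) - (R * A * S - A * (R * S))"
    using assms(1-3) unfolding commutator_def
    by (simp add: mat_arith)
  also have "\<dots> = (R * S * A - R * A * S) - (S * A * R - A * (S * R))"
    using assms by (subst mix) (auto simp: mat_arith)
  also have "\<dots> = commutator R (commutator S A)"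
    using assms(1-3) unfolding commutator_def
    by (simp add: mat_arith)
  finally show ?thesis .
qed

lemma trace_adjoint_mult_self:
  assumes "A \<in> carrier_mat n n"
  shows "mat_trace (mat_adjoint A * A) = of_real (\<Sum>i<n. \<Sum>j<n. (cmod (A $$ (j, i)))\<^sup>2)"
  using assms mat_adjoint_carrier[OF assms]
  by (simp add: mat_trace_def scalar_prod_def mat_adjoint_index[of A n n] atLeast0LessThan
      complex_norm_square mult.commute del: of_real_power)

lemma trace_adjoint_mult_self_eq_0:
  assumes "A \<in> carrier_mat n n" "(\<Sum>i<n. \<Sum>j<n. (cmod (A $$ (j, i)))\<^sup>2) = 0"
  shows "A = 0\<^sub>m n n"
proof -
  have "A $$ (j, i) = 0" if "i < n" "j < n" for i j
  proof -
    have "(\<Sum>j<n. (cmod (A $$ (j, i)))\<^sup>2) = 0"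
      using assms(2) that by (subst (asm) sum_nonneg_eq_0_iff) (auto intro: sum_nonneg)
    then show ?thesis using that by (subst (asm) sum_nonneg_eq_0_iff) auto
  qed
  then show ?thesis using assms(1) by (intro eq_matI) auto
qed

lemma mat_adjoint_add:
  "A \<in> carrier_mat n n \<Longrightarrow> B \<in> carrier_mat n n \<Longrightarrow> mat_adjoint (A + B) = mat_adjoint A + (mat_adjoint B :: complex mat)"
  using mat_adjoint_carrier[of A n n] mat_adjoint_carrier[of B n n] mat_adjoint_carrier[of "A + B" n n]
  by (intro eq_matI) (auto simp: mat_adjoint_index[of _ n n])

lemma mat_adjoint_smult:
  "A \<in> carrier_mat n n \<Longrightarrow> mat_adjoint (c \<cdot>\<^sub>m A) = cnj c \<cdot>\<^sub>m (mat_adjoint A :: complex mat)"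
  using mat_adjoint_carrier[of A n n] mat_adjoint_carrier[of "c \<cdot>\<^sub>m A" n n]
  by (intro eq_matI) (auto simp: mat_adjoint_index[of _ n n])

lemma mat_adjoint_diff:
  "A \<in> carrier_mat n n \<Longrightarrow> B \<in> carrier_mat n n \<Longrightarrow> mat_adjoint (A - B) = mat_adjoint A - (mat_adjoint B :: complex mat)"
  using mat_adjoint_carrier[of A n n] mat_adjoint_carrier[of B n n] mat_adjoint_carrier[of "A - B" n n]
    minus_carrier_mat[of B n n A]
  by (intro eq_matI) (auto simp: mat_adjoint_index[of _ n n])

lemma mat_adjoint_mult:
  "A \<in> carrier_mat n n \<Longrightarrow> B \<in> carrier_mat n n \<Longrightarrow> mat_adjoint (A * B) = mat_adjoint B * (mat_adjoint A :: complex mat)"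
  using mat_adjoint_carrier[of A n n] mat_adjoint_carrier[of B n n] mat_adjoint_carrier[of "A * B" n n]
  by (intro eq_matI) (auto simp: mat_adjoint_index[of _ n n] scalar_prod_def mult.commute intro!: sum.cong)

lemma mat_adjoint_commutator:
  assumes "A \<in> carrier_mat n n" "B \<in> carrier_mat n n"
  shows "mat_adjoint (commutator A B) = commutator (mat_adjoint B) (mat_adjoint A)"
  using assms by (simp add: commutator_def mat_adjoint_diff mat_adjoint_mult)

lemma uminus_eq_smult: "- A = (- 1) \<cdot>\<^sub>m (A :: complex mat)"
  by (intro eq_matI) auto

lemma minus_eq_add_smult: "A - B = A + (- 1) \<cdot>\<^sub>m (B :: complex mat)" if "A \<in> carrier_mat n n" "B \<in> carrier_mat n n"
  using that by (intro eq_matI) auto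

lemma commutator_uminus_uminus:
  "A \<in> carrier_mat n n \<Longrightarrow> B \<in> carrier_mat n n \<Longrightarrow> commutator (- A) (- B) = commutator A B"
  by (simp add: commutator_def uminus_eq_smult mat_arith)
    (intro eq_matI, auto)

lemma su_carrier: "A \<in> su n \<Longrightarrow> A \<in> carrier_mat n n"
  by (simp add: su_def)

lemma su_add: "A \<in> su n \<Longrightarrow> B \<in> su n \<Longrightarrow> A + B \<in> su n"
  by (auto simp: su_def mat_adjoint_add mat_trace_add intro!: eq_matI)

lemma su_smult: "A \<in> su n \<Longrightarrow> of_real r \<cdot>\<^sub>m A \<in> su n"
  by (auto simp: su_def mat_adjoint_smult mat_trace_smult intro!: eq_matI)

lemma su_diff: "A \<in> su n \<Longrightarrow> B \<in> su n \<Longrightarrow> A - B \<in> su n"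
  using su_add[OF _ su_smult[of B "-1"], of A] by (simp add: minus_eq_add_smult su_carrier)

lemma su_commutator:
  assumes "A \<in> su n" "B \<in> su n"
  shows "commutator A B \<in> su n"
proof -
  have c: "A \<in> carrier_mat n n" "B \<in> carrier_mat n n" using assms by (auto simp: su_def)
  have "mat_adjoint (commutator A B) = commutator B A"
    using assms c by (simp add: mat_adjoint_commutator su_def commutator_uminus_uminus)
  moreover have "mat_trace (commutator A B) = 0"
    using c mat_trace_mult_commute[OF c] by (simp add: commutator_def mat_trace_diff)
  ultimately show ?thesis using c by (simp add: su_def commutator_swap[of A B])
qed

lemma su_bracket: "A \<in> su n \<Longrightarrow> B \<in> su n \<Longrightarrow> bracket \<alpha> A B \<in> su n"
  by (simp add: bracket_def su_smult su_commutator)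

end

section \<open>The matrices T: entries, products, adjoints and traces\<close>

locale zeitlin =
  fixes N :: nat and \<alpha> :: real
  assumes N3: "N \<ge> 3" and oddN: "odd N" and \<alpha>pos: "\<alpha> > 0"
begin

lemma Npos [simp]: "N > 0" "N \<noteq> 0" using N3 by auto

abbreviation e :: "int \<Rightarrow> complex" where "e m \<equiv> omega_half N powi m"

lemma e_add: "e (m + n) = e m * e n"
  by (simp add: power_int_add)

text \<open>Congruences modulo \<open>N\<close> may be used for even exponents only:
  \<open>e (2 * m)\<close> is a power of the primitive \<open>N\<close>-th root of unity
  \<open>omega N\<close>, whereas \<open>e\<close> itself has period \<open>2 * N\<close>.\<close>

lemma e_period: "int N dvd m \<Longrightarrow> e (2 * m) = 1"
proof (elim dvdE)
  fix j assume "m = int N * j"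
  then have "pi * of_int (2 * m) / N = 2 * pi * of_int j" by simp
  then show ?thesis by (simp only: powi_omega_half cis_multiple_2pi Ints_of_int)
qed

lemma e_eq_1D: "e (2 * m) = 1 \<Longrightarrow> int N dvd m"
proof -
  assume "e (2 * m) = 1"
  then have "cos (2 * pi * of_int m / N) = 1"
    by (simp add: powi_omega_half complex_eq_iff mult_ac)
  then obtain j :: int where "2 * pi * of_int m / N = of_int j * (2 * pi)"
    by (auto simp: cos_one_2pi_int)
  then have "of_int m = of_int (j * int N) + (0::real)" by (simp add: field_simps)
  then have "m = j * int N" by (simp only: add_0_right of_int_eq_iff)
  then show ?thesis by simp
qed

text \<open>Candidates for the powers of clock and shift with any integer exponent. The factor 2 is
  there because \<open>e\<close> counts powers of \<open>omega_half N\<close>. In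
  \<open>shift_power\<close> below, the ones are located by a divisibility, so that negative
  exponents need no separate case.\<close>

definition clock_power :: "int \<Rightarrow> complex mat" where
  "clock_power n = mat_diag N (\<lambda>j. e (2 * n * int j))"

definition shift_power :: "int \<Rightarrow> complex mat" where
  "shift_power n = mat N N (\<lambda>(a, b). if int N dvd int b - int a - n then 1 else 0)"

text \<open>Each row of a power of the shift has a single nonzero entry, so a sum in a matrix
  product collapses to one column. \<open>residue_dvd\<close> then replaces the representative of
  that column by the unreduced integer.\<close>

lemma sum_single_residue:
  fixes f :: "nat \<Rightarrow> complex"
  shows "(\<Sum>j\<in>{0..<N}. if int N dvd int j - n then f j else 0) = f (nat (n mod int N))"
proof -
  have "int N dvd int j - n \<longleftrightarrow> j = nat (n mod int N)" if "j < N" for j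
  proof
    assume "int N dvd int j - n"
    then have "int j mod int N = n mod int N" by (simp add: mod_eq_dvd_iff)
    then show "j = nat (n mod int N)" using that by simp
  next
    assume "j = nat (n mod int N)"
    then have "int j = n mod int N" by simp
    then show "int N dvd int j - n" by (metis mod_eq_dvd_iff mod_mod_trivial)
  qed
  then have "(\<Sum>j\<in>{0..<N}. if int N dvd int j - n then f j else 0)
      = (\<Sum>j\<in>{0..<N}. if j = nat (n mod int N) then f j else 0)"
    by (intro sum.cong) auto
  also have "\<dots> = f (nat (n mod int N))"
    by (simp add: sum.delta nat_less_iff)
  finally show ?thesis .
qed

lemma residue_dvd: "int N dvd b - int (nat (n mod int N)) - m \<longleftrightarrow> int N dvd b - n - m"
proof -
  have "int (nat (n mod int N)) = n - int N * (n div int N)" by (simp add: minus_mult_div_eq_mod)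
  then have "b - int (nat (n mod int N)) - m = (b - n - m) + int N * (n div int N)"
    by linarith
  then show ?thesis by (metis dvd_add_times_triv_right_iff mult.commute)
qed

lemma clock_power_carrier [simp]: "clock_power n \<in> carrier_mat N N"
  and shift_power_carrier [simp]: "shift_power n \<in> carrier_mat N N"
  by (simp_all add: clock_power_def shift_power_def)

lemma clock_power_mult: "clock_power m * clock_power n = clock_power (m + n)"
  by (simp add: clock_power_def algebra_simps e_add)

lemma clock_power_0: "clock_power 0 = 1\<^sub>m N"
  by (simp add: clock_power_def)

lemma shift_power_mult: "shift_power m * shift_power n = shift_power (m + n)"
proof (rule eq_matI)
  fix a b assume "a < dim_row (shift_power (m + n))" "b < dim_col (shift_power (m + n))"
  then have ab: "a < N" "b < N" by (auto simp: shift_power_def)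
  have "(shift_power m * shift_power n) $$ (a, b) =
     (\<Sum>j\<in>{0..<N}. if int N dvd int j - (int a + m)
        then (if int N dvd int b - int j - n then 1 else 0) else 0)"
    using ab by (auto simp: shift_power_def scalar_prod_def diff_diff_eq intro!: sum.cong)
  also have "\<dots> = shift_power (m + n) $$ (a, b)"
    unfolding sum_single_residue residue_dvd using ab by (simp add: shift_power_def diff_diff_eq add.assoc)
  finally show "(shift_power m * shift_power n) $$ (a, b) = shift_power (m + n) $$ (a, b)" .
qed (auto simp: shift_power_def)

lemma dvd_diff_index: "a < N \<Longrightarrow> b < N \<Longrightarrow> int N dvd int b - int a \<longleftrightarrow> a = b"
  by (metis mod_eq_dvd_iff mod_less nat_int of_nat_mod)

lemma shift_power_0: "shift_power 0 = 1\<^sub>m N"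
  by (rule eq_matI) (auto simp: shift_power_def dvd_diff_index)

lemma clock_mat_eq: "clock_mat N = clock_power 1"
  by (simp add: clock_mat_def clock_power_def omega_eq power_int_power' del: power_int_numeral)

lemma shift_mat_eq: "shift_mat N = shift_power 1"
proof -
  have "j = (i + 1) mod N \<longleftrightarrow> int N dvd int j - int i - 1" if "j < N" for i j
  proof -
    have "j = (i + 1) mod N \<longleftrightarrow> int j mod int N = (int i + 1) mod int N"
      using that by (metis mod_less of_nat_1 of_nat_add of_nat_eq_iff of_nat_mod)
    then show ?thesis by (simp add: mod_eq_dvd_iff diff_diff_eq)
  qed
  then show ?thesis
    unfolding shift_mat_def shift_power_def by (intro cong_mat) auto
qed

text \<open>A homomorphism from the integers to matrices is determined by its value at 1. For
  negative exponents, \<open>P (- 1)\<close> is a two-sided inverse of \<open>P 1\<close> and hence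
  the matrix that \<open>mat_inverse\<close> returns.\<close>

lemma mat_powi_hom:
  assumes carrier: "\<And>n. P n \<in> carrier_mat N N" and zero: "P 0 = 1\<^sub>m N"
    and mult: "\<And>m n. P m * P n = P (m + n)"
  shows "mat_powi (P 1) n = P n"
proof -
  have pow: "P m ^\<^sub>m j = P (m * int j)" for m j
  proof (induction j)
    case 0
    then show ?case using carrier[of m] zero by simp
  next
    case (Suc j)
    then show ?case by (simp add: mult algebra_simps)
  qed
  have "mat_inverse (P 1) = Some (P (- 1))"
    by (intro mat_inverse_eqI[of _ N]) (auto simp: carrier zero mult)
  then show ?thesis by (simp add: mat_powi_def pow)
qed

definition cN :: complex where "cN = - (\<i> * of_nat N / (2 * of_real pi))"

lemma T_entries:
  "T N p = mat N N (\<lambda>(a, b). if int N dvd int b - int a - snd p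
     then cN * e (fst p * snd p + 2 * fst p * int a) else 0)"
proof -
  have "mat_powi (clock_mat N) n = clock_power n" "mat_powi (shift_mat N) n = shift_power n" for n
    unfolding clock_mat_eq shift_mat_eq
    by (intro mat_powi_hom clock_power_0 clock_power_mult shift_power_0 shift_power_mult, simp)+
  then have "T N p = (cN * e (fst p * snd p)) \<cdot>\<^sub>m (clock_power (fst p) * shift_power (snd p))"
    by (simp add: T_def cN_def)
  also have "clock_power (fst p) * shift_power (snd p)
     = mat N N (\<lambda>(a, b). e (2 * fst p * int a) * shift_power (snd p) $$ (a, b))"
    unfolding clock_power_def by (rule mat_diag_mult_left) simp
  finally show ?thesis
    by (auto simp: shift_power_def e_add intro!: eq_matI)
qed

lemma T_carrier [simp]: "T N p \<in> carrier_mat N N"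
  by (simp add: T_entries)

lemma T_dim [simp]: "dim_row (T N p) = N" "dim_col (T N p) = N"
  by (simp_all add: T_entries)

text \<open>Moving the clock past the shift costs a phase. The symmetric prefactor
  \<open>e (fst k * snd k)\<close> in \<open>T\<close> splits it evenly, which leaves exactly the
  antisymmetric exponent \<open>- cross p q\<close>.\<close>

lemma T_mult: "T N p * T N q = (cN * e (- cross p q)) \<cdot>\<^sub>m T N (p + q)"
proof (rule eq_matI)
  fix a b assume "a < dim_row ((cN * e (- cross p q)) \<cdot>\<^sub>m T N (p + q))"
    "b < dim_col ((cN * e (- cross p q)) \<cdot>\<^sub>m T N (p + q))"
  then have ab: "a < N" "b < N" by (auto simp: T_entries)
  let ?j = "nat ((int a + snd p) mod int N)"
  have "(T N p * T N q) $$ (a, b) =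
     (\<Sum>j\<in>{0..<N}. if int N dvd int j - (int a + snd p)
        then cN * e (fst p * snd p + 2 * fst p * int a) *
          (if int N dvd int b - int j - snd q then cN * e (fst q * snd q + 2 * fst q * int j) else 0)
        else 0)"
    using ab by (auto simp: T_entries scalar_prod_def diff_diff_eq intro!: sum.cong)
  also have "\<dots> = cN * e (fst p * snd p + 2 * fst p * int a) *
          (if int N dvd int b - (int a + snd p) - snd q
           then cN * e (fst q * snd q + 2 * fst q * int ?j) else 0)"
    by (simp only: sum_single_residue residue_dvd)
  \<comment> \<open>\<open>?j\<close> is congruent to \<open>int a + snd p\<close> modulo
    \<open>N\<close> and enters the exponent with a factor 2, so \<open>e_period\<close>
    applies.\<close>
  also have "e (fst q * snd q + 2 * fst q * int ?j) = e (fst q * snd q + 2 * fst q * (int a + snd p))"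
  proof -
    have "int N dvd fst q * (int ?j - (int a + snd p))"
      by (intro dvd_mult) (simp add: mod_eq_dvd_iff[symmetric])
    from e_period[OF this]
    have "e (fst q * snd q + 2 * fst q * (int a + snd p) + 2 * (fst q * (int ?j - (int a + snd p))))
       = e (fst q * snd q + 2 * fst q * (int a + snd p))"
      by (subst e_add) simp
    then show ?thesis by (simp add: algebra_simps)
  qed
  also have "cN * e (fst p * snd p + 2 * fst p * int a) *
          (if int N dvd int b - (int a + snd p) - snd q
           then cN * e (fst q * snd q + 2 * fst q * (int a + snd p)) else 0)
     = ((cN * e (- cross p q)) \<cdot>\<^sub>m T N (p + q)) $$ (a, b)"
  proof -
    have "e (fst p * snd p + 2 * fst p * int a) * e (fst q * snd q + 2 * fst q * (int a + snd p))
       = e (- cross p q) * e (fst (p + q) * snd (p + q) + 2 * fst (p + q) * int a)"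
      unfolding e_add[symmetric] by (simp add: cross_def algebra_simps)
    then show ?thesis using ab by (auto simp: T_entries algebra_simps)
  qed
  finally show "(T N p * T N q) $$ (a, b) = ((cN * e (- cross p q)) \<cdot>\<^sub>m T N (p + q)) $$ (a, b)" .
qed (auto simp: T_entries)

text \<open>Where the entries are nonzero, the congruence between row and column makes the
  conjugated phases agree with those at \<open>- p\<close>. The minus sign comes from
  \<open>cN\<close>, which is purely imaginary.\<close>

lemma T_adjoint: "mat_adjoint (T N p) = - T N (- p)"
proof (rule eq_matI)
  fix a b assume "a < dim_row (- T N (- p))" "b < dim_col (- T N (- p))"
  then have ab: "a < N" "b < N" by (auto simp: T_entries)
  have dvd: "int N dvd int a - int b - snd p \<longleftrightarrow> int N dvd int b - int a + snd p"
    by (metis diff_diff_eq2 diff_minus_eq_add dvd_minus_iff minus_diff_eq add.commute)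
  have "cnj (e (fst p * snd p + 2 * fst p * int b)) = e (fst p * snd p - 2 * fst p * int a)"
    if "int N dvd int b - int a + snd p"
  proof -
    have "e (2 * (fst p * (int b - int a + snd p))) = 1"
      using that by (intro e_period) simp
    moreover have "cnj (e m) = e (- m)" for m by (simp add: powi_omega_half cis_cnj)
    moreover have "e (fst p * snd p - 2 * fst p * int a)
        = e (- (fst p * snd p + 2 * fst p * int b)) * e (2 * (fst p * (int b - int a + snd p)))"
      unfolding e_add[symmetric] by (simp add: algebra_simps)
    ultimately show ?thesis by simp
  qed
  then show "mat_adjoint (T N p) $$ (a, b) = (- T N (- p)) $$ (a, b)"
    using ab by (auto simp: mat_adjoint_index[of _ N N] T_entries dvd cN_def)
qed (auto simp: T_entries mat_adjoint_def)

text \<open>The indices \<open>p\<close> for which \<open>T N p\<close> is a scalar matrix and \<open>eigval N \<alpha> p = 0\<close>.\<close>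

abbreviation zero_mod :: "int \<times> int \<Rightarrow> bool" where
  "zero_mod p \<equiv> int N dvd fst p \<and> int N dvd snd p"

text \<open>Either the support misses the diagonal, or the diagonal is a geometric progression whose
  ratio is an \<open>N\<close>-th root of unity other than 1.\<close>

lemma T_trace:
  assumes "\<not> zero_mod p"
  shows "mat_trace (T N p) = 0"
proof (cases "int N dvd snd p")
  case False
  then show ?thesis by (simp add: mat_trace_def T_entries)
next
  case True
  have "e (2 * fst p) \<noteq> 1" using assms True e_eq_1D by blast
  moreover have "e (2 * fst p) ^ N = 1"
    using e_period[of "fst p * int N"] by (simp only: power_int_power' mult.assoc dvd_triv_right)
  ultimately have "(\<Sum>a<N. e (2 * fst p) ^ a) = 0"
    by (simp add: geometric_sum)
  then have "(\<Sum>a<N. cN * e (fst p * snd p) * e (2 * fst p) ^ a) = 0"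
    by (simp only: sum_distrib_left[symmetric] mult_zero_right)
  then show ?thesis using True by (simp add: mat_trace_def T_entries e_add power_int_power' mult_ac del: power_int_mult_distrib_numeral1)
qed

lemma T_0: "T N 0 = cN \<cdot>\<^sub>m 1\<^sub>m N"
  by (rule eq_matI) (auto simp: T_entries dvd_diff_index)

lemmas mats = mat_arith[where n = N]

section \<open>Symmetry of the Laplacian; symmetry and definiteness of the metric\<close>

abbreviation "L \<equiv> adj_laplacian N \<alpha>"
abbreviation "g \<equiv> metric N \<alpha>"
abbreviation "ev \<equiv> eigval N \<alpha>"

lemma L_carrier [simp]: "A \<in> carrier_mat N N \<Longrightarrow> L A \<in> carrier_mat N N"
  by (simp add: adj_laplacian_def)

lemma L_add: "A \<in> carrier_mat N N \<Longrightarrow> B \<in> carrier_mat N N \<Longrightarrow> L (A + B) = L A + L B"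
  unfolding adj_laplacian_def
  by (simp add: commutator_add_right[of _ N]) (intro eq_matI, auto simp: algebra_simps)

lemma L_smult: "A \<in> carrier_mat N N \<Longrightarrow> L (c \<cdot>\<^sub>m A) = c \<cdot>\<^sub>m L A"
  unfolding adj_laplacian_def
  by (simp add: commutator_smult_right[of _ N]) (intro eq_matI, auto simp: algebra_simps)

text \<open>Invariance of the trace form moves both commutators onto \<open>A\<close>, in reversed
  order and with two cancelling signs. \<open>commutator_commute\<close> restores the order.\<close>

lemma trace_commutator_adjoint:
  assumes "A \<in> carrier_mat n n" "B \<in> carrier_mat n n" "S \<in> carrier_mat n n" "R \<in> carrier_mat n n"
    "S * R = R * S"
  shows "mat_trace (A * commutator S (commutator R B)) = mat_trace (commutator S (commutator R A) * B)"
proof -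
  have "mat_trace (A * commutator S (commutator R B)) = mat_trace (commutator (commutator A S) R * B)"
    using assms by (simp add: trace_mult_commutator[of _ n])
  also have "commutator (commutator A S) R = commutator R (commutator S A)"
    using assms(1-4)
    by (simp add: commutator_swap[of R n] commutator_swap[of S n A])
      (simp add: uminus_eq_smult commutator_smult_left[of _ n] commutator_smult_right[of _ n], intro eq_matI, auto)
  finally show ?thesis using commutator_commute[OF assms(1,3,4,5)] by simp
qed

lemma L_selfadjoint:
  assumes "A \<in> carrier_mat N N" "B \<in> carrier_mat N N"
  shows "mat_trace (A * L B) = mat_trace (L A * B)"
proof -
  have "T N p * T N (- p) = T N (- p) * T N p" for p
    by (simp add: T_mult cross_def)
  from this[of "(0, 1)"] this[of "(1, 0)"] show ?thesis
    using assms unfolding adj_laplacian_def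
    by (simp add: mats mat_trace_add[of _ N]
        mats mat_trace_smult[of _ N]
        trace_commutator_adjoint[of _ N])
qed

text \<open>On \<open>su N\<close> the adjoint is \<open>- A\<close>, which absorbs the sign in
  \<open>metric\<close>. What remains is linear in both arguments, so the symmetry of
  \<open>L\<close> becomes symmetry of the metric.\<close>

lemma metric_su:
  assumes "A \<in> su N" "B \<in> carrier_mat N N"
  shows "g A B = of_real (hbar N) * mat_trace (A * L B)"
proof -
  have "mat_adjoint A = (- 1) \<cdot>\<^sub>m A" "A \<in> carrier_mat N N"
    using assms(1) by (auto simp: su_def uminus_eq_smult)
  then show ?thesis
    using assms(2) by (simp add: metric_def mats mat_trace_smult[of _ N])
qed

lemma metric_commute:
  assumes "A \<in> su N" "B \<in> su N"
  shows "g A B = g B A"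
proof -
  have c: "A \<in> carrier_mat N N" "B \<in> carrier_mat N N"
    using assms by (auto intro: su_carrier)
  have "mat_trace (A * L B) = mat_trace (B * L A)"
    unfolding L_selfadjoint[OF c] by (rule mat_trace_mult_commute) (use c in auto)
  then show ?thesis using assms c by (simp add: metric_su)
qed

lemma metric_add_left:
  assumes "A \<in> su N" "B \<in> su N" "C \<in> su N"
  shows "g (A + B) C = g A C + g B C"
  using assms su_add[OF assms(1,2)] assms[THEN su_carrier]
  by (simp add: metric_su mats mat_trace_add[of _ N] distrib_left)

lemma metric_smult_left:
  assumes "A \<in> su N" "C \<in> su N"
  shows "g (of_real r \<cdot>\<^sub>m A) C = of_real r * g A C"
  using assms su_smult[OF assms(1)] assms[THEN su_carrier]
  by (simp add: metric_su mats mat_trace_smult[of _ N])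

lemma metric_add_right:
  assumes "A \<in> su N" "B \<in> su N" "C \<in> su N"
  shows "g C (A + B) = g C A + g C B"
  using metric_add_left[OF assms] assms by (simp add: metric_commute[of C] su_add)

lemma metric_smult_right:
  assumes "A \<in> su N" "C \<in> su N"
  shows "g C (of_real r \<cdot>\<^sub>m A) = of_real r * g C A"
  using metric_smult_left[OF assms] assms by (simp add: metric_commute[of C] su_smult)

lemma metric_diff_left:
  assumes "A \<in> su N" "B \<in> su N" "C \<in> su N"
  shows "g (A - B) C = g A C - g B C"
  using metric_add_left[OF assms(1) su_smult[OF assms(2), of "-1"] assms(3)]
    metric_smult_left[OF assms(2,3), of "-1"] assms[THEN su_carrier]
  by (simp add: minus_eq_add_smult[of _ N])

lemma hbar_pos: "hbar N > 0"
  by (simp add: hbar_def)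

text \<open>\<open>T N (1, 0)\<close> is a multiple of the clock, whose diagonal entries are
  distinct, so \<open>A\<close> is diagonal. \<open>T N (0, 1)\<close> is a multiple of the shift,
  so neighbouring diagonal entries of \<open>A\<close> agree. Trace 0 excludes nonzero scalar
  matrices.\<close>

lemma commutant_trivial:
  assumes A: "A \<in> carrier_mat N N" and tr: "mat_trace A = 0"
    and c1: "commutator (T N (0, 1)) A = 0\<^sub>m N N" and c2: "commutator (T N (1, 0)) A = 0\<^sub>m N N"
  shows "A = 0\<^sub>m N N"
proof -
  have cN: "cN \<noteq> 0" by (simp add: cN_def)
  have eqI: "(P * A) $$ (a, b) = (A * P) $$ (a, b)"
    if "P \<in> carrier_mat N N" "commutator P A = 0\<^sub>m N N" "a < N" "b < N" for P a b
  proof -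
    have "(P * A - A * P) $$ (a, b) = 0" using that by (simp add: commutator_def)
    then show ?thesis using that A by (simp del: index_mult_mat(1))
  qed
  have off: "A $$ (a, b) = 0" if "a < N" "b < N" "a \<noteq> b" for a b
  proof -
    have "(T N (1, 0) * A) $$ (a, b) = cN * e (2 * int a) * A $$ (a, b)"
      using that A by (simp add: T_entries scalar_prod_def dvd_diff_index if_distrib[of "\<lambda>x. x * _"] cong: if_cong)
    moreover have "(A * T N (1, 0)) $$ (a, b) = A $$ (a, b) * (cN * e (2 * int b))"
      using that A by (simp add: T_entries scalar_prod_def dvd_diff_index if_distrib[of "\<lambda>x. _ * x"] cong: if_cong)
    ultimately have "A $$ (a, b) = 0 \<or> e (2 * int a) = e (2 * int b)"
      using eqI[OF T_carrier c2 that(1,2)] cN by auto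
    moreover have "e (2 * int a) \<noteq> e (2 * int b)"
    proof
      assume "e (2 * int a) = e (2 * int b)"
      then have "e (2 * (int a - int b)) = 1"
        by (simp add: right_diff_distrib power_int_diff)
      then show False using that e_eq_1D dvd_diff_index by blast
    qed
    ultimately show ?thesis by blast
  qed
  have "A $$ (Suc a, Suc a) = A $$ (a, a)" if "Suc a < N" for a
  proof -
    have "int N dvd int j - int a - 1 \<longleftrightarrow> j = Suc a" if "j < N" for j
      using dvd_diff_index[OF \<open>Suc a < N\<close> that] by (auto simp: algebra_simps)
    then have "(T N (0, 1) * A) $$ (a, Suc a) = cN * A $$ (Suc a, Suc a)"
      using that A by (simp add: T_entries scalar_prod_def if_distrib[of "\<lambda>x. x * _"] cong: if_cong)
    moreover have "(A * T N (0, 1)) $$ (a, Suc a) = A $$ (a, a) * cN"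
      using that A by (simp add: T_entries scalar_prod_def dvd_diff_index if_distrib[of "\<lambda>x. _ * x"] cong: if_cong)
    ultimately show ?thesis using eqI[OF T_carrier c1, of a "Suc a"] that cN by simp
  qed
  then have diag: "a < N \<Longrightarrow> A $$ (a, a) = A $$ (0, 0)" for a
    by (induction a) auto
  have "(\<Sum>a<N. A $$ (a, a)) = (\<Sum>a<N. A $$ (0, 0))"
    by (intro sum.cong refl diag) simp
  then have "A $$ (0, 0) = 0"
    using tr A by (simp add: mat_trace_def)
  then have "A $$ (a, b) = 0" if "a < N" "b < N" for a b
    using that diag[of a] off[of a b] by (cases "a = b") auto
  then show ?thesis
    using A by (intro eq_matI) auto
qed

text \<open>\<open>g A A\<close> is a positive combination of the squared Hilbert-Schmidt norms of \<open>[T\<^bsub>(0,1)\<^esub>, A]\<close> and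
  \<open>[T\<^bsub>(1,0)\<^esub>, A]\<close>, since \<open>T\<^bsub>-p\<^esub>\<close> is minus the adjoint of \<open>T\<^bsub>p\<^esub>\<close>.\<close>

lemma metric_definite:
  assumes A: "A \<in> su N" and "g A A = 0"
  shows "A = 0\<^sub>m N N"
proof -
  have c: "A \<in> carrier_mat N N" using A by (rule su_carrier)
  define h where "h p = (\<Sum>i<N. \<Sum>j<N. (cmod (commutator (T N p) A $$ (j, i)))\<^sup>2)" for p
  have h: "mat_trace (A * commutator (T N (- p)) (commutator (T N p) A)) = of_real (h p)" for p
  proof -
    have "mat_adjoint (commutator (T N p) A) = commutator (- A) (- T N (- p))"
      using A c by (simp add: mat_adjoint_commutator[of _ N] T_adjoint su_def)
    also have "\<dots> = commutator A (T N (- p))"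
      using c by (simp add: commutator_uminus_uminus[of _ N])
    finally show ?thesis
      using c trace_adjoint_mult_self[of "commutator (T N p) A" N]
      by (simp add: trace_mult_commutator[of _ N] h_def)
  qed
  have "g A A = of_real (hbar N * (\<alpha>\<^sup>2 * h (0, 1) + h (1, 0)))"
    using A c h[of "(0, 1)"] h[of "(1, 0)"]
    by (simp add: metric_su adj_laplacian_def mats mat_trace_add[of _ N]
        mats mat_trace_smult[of _ N])
  then have "\<alpha>\<^sup>2 * h (0, 1) + h (1, 0) = 0"
    using assms(2) hbar_pos by (metis less_irrefl mult_eq_0_iff of_real_eq_0_iff)
  moreover have "h p \<ge> 0" for p by (simp add: h_def sum_nonneg)
  ultimately have "h (0, 1) = 0" "h (1, 0) = 0"
    using \<alpha>pos by (auto simp: add_nonneg_eq_0_iff)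
  then have "commutator (T N (0, 1)) A = 0\<^sub>m N N" "commutator (T N (1, 0)) A = 0\<^sub>m N N"
    unfolding h_def using c by (auto intro!: trace_adjoint_mult_self_eq_0)
  then show ?thesis using commutant_trivial[OF c] A by (simp add: su_def)
qed

section \<open>Structure constants, eigenvalues of the Laplacian, and the bracket of waves\<close>

lemma cross_minus [simp]: "cross (- p) q = - cross p q" "cross p (- q) = - cross p q"
  by (simp_all add: cross_def)

lemma cross_add_self [simp]: "cross (q + p) q = cross p q"
  by (simp add: cross_def algebra_simps)

lemma cross_swap: "cross q p = - cross p q"
  by (simp add: cross_def)

lemma struct_const_minus: "struct_const N (- p) q = - struct_const N p q"
    "struct_const N p (- q) = - struct_const N p q"
  by (simp_all add: struct_const_def)

text \<open>The two products are the same multiple of \<open>T N (p + q)\<close> up to opposite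
  phases, so their difference carries \<open>2 * \<i> * sin t\<close>. The factor \<open>cN\<close>
  is normalized to make the result real.\<close>

lemma commutator_T:
  "commutator (T N p) (T N q) = of_real (struct_const N q p) \<cdot>\<^sub>m T N (p + q)"
proof -
  define t where "t = pi / N * of_int (cross q p)"
  have e: "e (- cross p q) = cis t" "e (- cross q p) = cis (- t)"
    by (simp_all add: powi_omega_half t_def cross_swap[of q p])
  have cis: "cis t - cis (- t) = 2 * \<i> * sin t"
    by (simp add: complex_eq_iff)
  have cN: "cN * (2 * \<i>) = of_real (N / pi)"
    by (simp add: cN_def mult.left_commute[of \<i>])
  have "cN * (cis t - cis (- t)) = of_real (N / pi) * of_real (sin t)"
    unfolding cis cN[symmetric] by (simp only: mult.assoc)
  then have "cN * cis t - cN * cis (- t) = of_real (struct_const N q p)"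
    by (simp add: struct_const_def t_def right_diff_distrib)
  moreover have "commutator (T N p) (T N q) = (cN * cis t - cN * cis (- t)) \<cdot>\<^sub>m T N (p + q)"
    unfolding commutator_def T_mult e by (intro eq_matI) (auto simp: add.commute left_diff_distrib)
  ultimately show ?thesis by simp
qed

text \<open>Bracketing with \<open>T N q\<close> and then with \<open>T N (- q)\<close> returns to
  the index \<open>p\<close> with factor minus the squared structure constant. The direction
  \<open>q = (0, 1)\<close> sees \<open>fst p\<close>, and \<open>q = (1, 0)\<close> sees
  \<open>snd p\<close>.\<close>

lemma L_T: "L (T N p) = of_real (ev p) \<cdot>\<^sub>m T N p"
proof -
  have *: "commutator (T N (- q)) (commutator (T N q) (T N p))
      = of_real (- (struct_const N p q)\<^sup>2) \<cdot>\<^sub>m T N p" for q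
  proof -
    have "struct_const N (q + p) (- q) = - struct_const N p q"
      by (simp add: struct_const_def)
    moreover have "- q + (q + p) = p" by simp
    ultimately show ?thesis
      by (simp add: commutator_T commutator_smult_right[of _ N] power2_eq_square del: minus_add_cancel)
        (auto intro!: eq_matI)
  qed
  have "struct_const N p (0, 1) = N / pi * sin (pi * of_int (fst p) / N)"
    "(struct_const N p (1, 0))\<^sup>2 = (N / pi * sin (pi * of_int (snd p) / N))\<^sup>2"
    by (simp_all add: struct_const_def cross_def)
  then show ?thesis
    using *[of "(0, 1)"] *[of "(1, 0)"]
    by (simp add: adj_laplacian_def eigval_def)
      (auto intro!: eq_matI simp: power_mult_distrib power_divide algebra_simps)
qed

text \<open>The conjugate coefficient makes the matrix skew-Hermitian, because the adjoint of
  \<open>T N p\<close> is \<open>- T N (- p)\<close>.\<close>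

definition wave :: "int \<times> int \<Rightarrow> complex \<Rightarrow> complex mat" where
  "wave p x = x \<cdot>\<^sub>m T N p + cnj x \<cdot>\<^sub>m T N (- p)"

lemma wave_carrier [simp]: "wave p x \<in> carrier_mat N N"
  by (simp add: wave_def)

lemma wave_dim [simp]: "dim_row (wave p x) = N" "dim_col (wave p x) = N"
  by (simp_all add: wave_def)

lemma X_eq_wave: "X N p = wave p (1 / 2)"
  unfolding X_def wave_def by (intro eq_matI) auto

lemma Y_eq_wave: "Y N p = wave p (1 / (2 * \<i>))"
  unfolding Y_def wave_def by (intro eq_matI) (auto simp: field_simps)

lemma wave_zero: "wave p 0 = 0\<^sub>m N N"
  unfolding wave_def by (intro eq_matI) auto

lemma wave_smult: "of_real r \<cdot>\<^sub>m wave p x = wave p (of_real r * x)"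
  unfolding wave_def by (intro eq_matI) (auto simp: algebra_simps)

lemma zero_mod_minus: "zero_mod (- p) \<longleftrightarrow> zero_mod p"
  by simp

text \<open>Since \<open>N\<close> is odd, 2 is a unit modulo \<open>N\<close>. Sums such as
  \<open>p + p\<close> arise when waves are paired under the trace.\<close>

lemma zero_mod_double: "zero_mod (p + p) \<longleftrightarrow> zero_mod p"
proof -
  have "coprime (int N) 2" using oddN by simp
  then have "int N dvd m + m \<longleftrightarrow> int N dvd m" for m
    by (metis coprime_dvd_mult_right_iff mult_2)
  then show ?thesis by simp
qed

lemma wave_su: "wave p x \<in> su N" if "\<not> zero_mod p"
proof -
  have "mat_adjoint (wave p x) = - wave p x"
    unfolding wave_def
    by (simp add: mat_adjoint_add[of _ N] mat_adjoint_smult[of _ N] T_adjoint)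
      (auto intro!: eq_matI)
  moreover have "mat_trace (wave p x) = 0"
    using that zero_mod_minus[of p]
    by (simp add: wave_def mat_trace_add[of _ N] mat_trace_smult[of _ N] T_trace del: fst_uminus snd_uminus)
  ultimately show ?thesis by (simp add: su_def)
qed

lemma L_wave: "L (wave p x) = wave p (of_real (ev p) * x)"
proof -
  have "ev (- p) = ev p" by (simp add: eigval_def)
  then show ?thesis
    unfolding wave_def by (simp add: L_add L_smult L_T) (auto intro!: eq_matI)
qed

text \<open>Of the four commutators, those at \<open>p + q\<close> and \<open>- (p + q)\<close> have
  conjugate coefficients, and so do those at \<open>p - q\<close> and \<open>q - p\<close>.\<close>

lemma bracket_wave:
  "bracket \<alpha> (wave p x) (wave q y) =
     wave (p + q) (of_real (\<alpha> * struct_const N q p) * (x * y))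
   + wave (p - q) (of_real (- \<alpha> * struct_const N q p) * (x * cnj y))"
  unfolding bracket_def wave_def
  by (simp add: commutator_add_left[of _ N] commutator_add_right[of _ N]
      commutator_smult_left[of _ N] commutator_smult_right[of _ N] commutator_T struct_const_minus)
    (auto intro!: eq_matI simp: algebra_simps)

lemma sin_eq_0_iff_dvd: "sin (pi * of_int m / N) = 0 \<longleftrightarrow> int N dvd m"
proof -
  have "pi * of_int m / N = of_int i * pi \<longleftrightarrow> m = int N * i" for i
  proof -
    have "pi * of_int m / N = of_int i * pi \<longleftrightarrow> real_of_int m = of_int (int N * i)"
      by (simp add: field_simps)
    then show ?thesis by (simp only: of_int_eq_iff)
  qed
  then show ?thesis by (simp add: sin_zero_iff_int2 dvd_def)
qed

lemma eigval_eq_0_iff: "ev p = 0 \<longleftrightarrow> zero_mod p"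
  using \<alpha>pos by (simp add: eigval_def add_nonneg_eq_0_iff sin_eq_0_iff_dvd)

text \<open>\<open>cross p q\<close> does not change when a multiple of \<open>q\<close> is added to
  \<open>p\<close>. This is why brackets never produce a component on which the Laplacian
  vanishes.\<close>

lemma struct_const_eq_0:
  assumes "zero_mod (p + q) \<or> zero_mod (p - q)"
  shows "struct_const N p q = 0"
proof -
  have "int N dvd cross p q"
    using assms
  proof
    assume "zero_mod (p + q)"
    moreover have "cross p q = fst (p + q) * snd q - snd (p + q) * fst q"
      by (simp add: cross_def algebra_simps)
    ultimately show ?thesis by simp
  next
    assume "zero_mod (p - q)"
    moreover have "cross p q = fst (p - q) * snd q - snd (p - q) * fst q"
      by (simp add: cross_def algebra_simps)
    ultimately show ?thesis by simp
  qed
  then show ?thesis using sin_eq_0_iff_dvd[of "cross p q"] by (simp add: struct_const_def)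
qed

section \<open>The real span of the waves: closure under the bracket, invertibility of the
  Laplacian\<close>

inductive_set modes :: "complex mat set" where
  wave: "\<not> zero_mod p \<Longrightarrow> wave p x \<in> modes"
| add: "A \<in> modes \<Longrightarrow> B \<in> modes \<Longrightarrow> A + B \<in> modes"

lemma modes_su: "A \<in> modes \<Longrightarrow> A \<in> su N"
  by (induction rule: modes.induct) (auto simp: wave_su su_add)

lemma modes_carrier [simp]: "A \<in> modes \<Longrightarrow> A \<in> carrier_mat N N"
  using modes_su su_carrier by blast

text \<open>Here \<open>p\<close> may vanish modulo \<open>N\<close>: the zero matrix is rewritten
  as the wave at \<open>(1, 1)\<close>, an admissible index because \<open>N\<close> is at least
  3.\<close>

lemma wave_0_modes: "wave p 0 \<in> modes"
  using modes.wave[of "(1, 1)" 0] N3 by (simp add: wave_zero)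

lemma modes_smult: "A \<in> modes \<Longrightarrow> of_real r \<cdot>\<^sub>m A \<in> modes"
proof (induction rule: modes.induct)
  case (add A B)
  then show ?case
    using modes.add by (simp add: add_smult_distrib_left_mat[of _ N N])
qed (auto simp: wave_smult intro: modes.wave)

lemma modes_diff: "A \<in> modes \<Longrightarrow> B \<in> modes \<Longrightarrow> A - B \<in> modes"
  using modes.add[OF _ modes_smult[of B "-1"], of A] by (simp add: minus_eq_add_smult[of _ N])

lemma modes_L: "A \<in> modes \<Longrightarrow> L A \<in> modes"
  by (induction rule: modes.induct) (auto simp: L_wave L_add intro: modes.intros)

lemma modes_L_surj: "A \<in> modes \<Longrightarrow> \<exists>W\<in>modes. L W = A"
proof (induction rule: modes.induct)
  case (wave p x)
  then have "L (wave p (x / of_real (ev p))) = wave p x"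
    using eigval_eq_0_iff[of p] by (simp add: L_wave)
  then show ?case using wave modes.wave by blast
next
  case (add A B)
  then obtain V W where "V \<in> modes" "L V = A" "W \<in> modes" "L W = B" by blast
  then have "V + W \<in> modes" "L (V + W) = A + B" by (auto simp: L_add intro: modes.add)
  then show ?case by blast
qed

lemma bracket_add_left: "A \<in> carrier_mat N N \<Longrightarrow> B \<in> carrier_mat N N \<Longrightarrow> C \<in> carrier_mat N N \<Longrightarrow>
    bracket \<alpha> (A + B) C = bracket \<alpha> A C + bracket \<alpha> B C"
  and bracket_add_right: "A \<in> carrier_mat N N \<Longrightarrow> B \<in> carrier_mat N N \<Longrightarrow> C \<in> carrier_mat N N \<Longrightarrow>
    bracket \<alpha> C (A + B) = bracket \<alpha> C A + bracket \<alpha> C B"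
  by (simp_all add: bracket_def commutator_add_left[of _ N] commutator_add_right[of _ N]
      add_smult_distrib_left_mat[of _ N N])

text \<open>If one of the indices \<open>p + q\<close>, \<open>p - q\<close> vanishes modulo
  \<open>N\<close>, then so does the structure constant, and the inadmissible wave has coefficient
  0.\<close>

lemma bracket_wave_modes: "bracket \<alpha> (wave p x) (wave q y) \<in> modes"
proof -
  have *: "wave r (of_real (t * struct_const N q p) * z) \<in> modes"
    if "r = p + q \<or> r = p - q" for r t z
  proof (cases "zero_mod r")
    case True
    then have "zero_mod (q + p) \<or> zero_mod (q - p)"
      using that by (auto simp: add.commute dvd_diff_commute[of "int N" "fst q"] dvd_diff_commute[of "int N" "snd q"])
    then have "struct_const N q p = 0" by (rule struct_const_eq_0)
    then show ?thesis by (simp add: wave_0_modes)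
  qed (rule modes.wave)
  then show ?thesis unfolding bracket_wave by (intro modes.add *) auto
qed

lemma modes_bracket:
  assumes "A \<in> modes" "B \<in> modes"
  shows "bracket \<alpha> A B \<in> modes"
  using assms
proof (induction A rule: modes.induct)
  case (wave p x)
  from wave(2) show ?case
    by (induction B rule: modes.induct)
      (auto simp: bracket_wave_modes bracket_add_right intro: modes.add)
qed (auto simp: bracket_add_left intro: modes.add)

section \<open>The operator \<open>ad_star\<close>, the connection, and a single curvature
  term\<close>

lemma ad_star_eqI:
  assumes A: "A \<in> su N" and B: "B \<in> su N" and W: "W \<in> su N"
    and LW: "L W = bracket \<alpha> (L B) A"
  shows "ad_star N \<alpha> A B = W"
    and "C \<in> su N \<Longrightarrow> g W C = g B (bracket \<alpha> A C)"
proof -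
  have adj: "g W C = g B (bracket \<alpha> A C)" if C: "C \<in> su N" for C
  proof -
    have c: "A \<in> carrier_mat N N" "B \<in> carrier_mat N N" "W \<in> carrier_mat N N" "C \<in> carrier_mat N N"
      using assms C by (auto intro: su_carrier)
    \<comment> \<open>Invariance of the trace form moves \<open>A\<close> to the other factor; with
      \<open>L\<close> symmetric this is the defining identity of \<open>ad_star\<close>.\<close>
    then have "mat_trace (L B * bracket \<alpha> A C) = mat_trace (bracket \<alpha> (L B) A * C)"
      by (simp add: bracket_def mats mat_trace_smult[of _ N] trace_mult_commutator[of _ N])
    then show ?thesis
      using B W C c by (simp add: metric_su L_selfadjoint LW su_carrier[OF su_bracket[OF A C]])
  qed
  then show "C \<in> su N \<Longrightarrow> g W C = g B (bracket \<alpha> A C)" .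
  show "ad_star N \<alpha> A B = W"
    unfolding ad_star_def
  proof (rule the_equality)
    fix V assume V: "V \<in> su N \<and> (\<forall>C\<in>su N. g V C = g B (bracket \<alpha> A C))"
    \<comment> \<open>Two solutions differ by a vector orthogonal to all of \<open>su N\<close>, in
      particular to itself.\<close>
    then have "g (V - W) (V - W) = 0"
      using W adj by (simp add: metric_diff_left su_diff)
    then have "V - W = 0\<^sub>m N N"
      using V W by (intro metric_definite) (auto simp: su_diff)
    moreover have "V = (V - W) + W"
      using V W by (auto intro!: eq_matI dest!: su_carrier)
    ultimately show "V = W" using W by (simp add: su_carrier)
  qed (use W adj in auto)
qed

lemma ad_star_modes:
  assumes "A \<in> modes" "B \<in> modes"
  shows "ad_star N \<alpha> A B \<in> modes"
    and "C \<in> su N \<Longrightarrow> g (ad_star N \<alpha> A B) C = g B (bracket \<alpha> A C)"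
proof -
  from assms have "bracket \<alpha> (L B) A \<in> modes" by (intro modes_bracket modes_L)
  then obtain W where W: "W \<in> modes" "L W = bracket \<alpha> (L B) A"
    using modes_L_surj by blast
  from ad_star_eqI[OF modes_su modes_su modes_su W(2)] assms W
  show "ad_star N \<alpha> A B \<in> modes" "C \<in> su N \<Longrightarrow> g (ad_star N \<alpha> A B) C = g B (bracket \<alpha> A C)"
    by auto
qed

lemma modes_nabla: "A \<in> modes \<Longrightarrow> B \<in> modes \<Longrightarrow> nabla N \<alpha> A B \<in> modes"
  using modes_smult[of _ "1 / 2"]
  by (simp add: nabla_def modes_diff ad_star_modes modes_bracket)

lemma bracket_swap: "A \<in> carrier_mat N N \<Longrightarrow> B \<in> carrier_mat N N \<Longrightarrow>
    bracket \<alpha> B A = of_real (- 1) \<cdot>\<^sub>m bracket \<alpha> A B"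
  by (auto simp: bracket_def commutator_def intro!: eq_matI simp: algebra_simps)

lemma metric_bracket_swap:
  assumes "A \<in> su N" "B \<in> su N" "C \<in> su N"
  shows "g (bracket \<alpha> B A) C = - g (bracket \<alpha> A B) C"
    and "g C (bracket \<alpha> B A) = - g C (bracket \<alpha> A B)"
proof -
  have "bracket \<alpha> B A = of_real (- 1) \<cdot>\<^sub>m bracket \<alpha> A B"
    using assms by (intro bracket_swap su_carrier)
  then show "g (bracket \<alpha> B A) C = - g (bracket \<alpha> A B) C" "g C (bracket \<alpha> B A) = - g C (bracket \<alpha> A B)"
    using assms metric_smult_left[of "bracket \<alpha> A B" C "- 1"] metric_smult_right[of "bracket \<alpha> A B" C "- 1"]
    by (simp_all add: su_bracket)
qed

lemma koszul:
  assumes "A \<in> modes" "B \<in> modes" "C \<in> modes"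
  shows "2 * g (nabla N \<alpha> A B) C = g (bracket \<alpha> A B) C - g B (bracket \<alpha> A C) - g A (bracket \<alpha> B C)"
proof -
  note su = modes_su[OF modes_bracket[OF assms(1,2)]] modes_su[OF ad_star_modes(1)[OF assms(1,2)]]
    modes_su[OF ad_star_modes(1)[OF assms(2,1)]] modes_su[OF assms(3)]
  have "nabla N \<alpha> A B = of_real (1 / 2) \<cdot>\<^sub>m (bracket \<alpha> A B - ad_star N \<alpha> A B - ad_star N \<alpha> B A)"
    by (simp add: nabla_def)
  then have "g (nabla N \<alpha> A B) C = of_real (1 / 2) * g (bracket \<alpha> A B - ad_star N \<alpha> A B - ad_star N \<alpha> B A) C"
    using su by (simp only: metric_smult_left su_diff)
  then have "2 * g (nabla N \<alpha> A B) C = g (bracket \<alpha> A B - ad_star N \<alpha> A B - ad_star N \<alpha> B A) C"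
    by (simp add: mult.commute)
  then show ?thesis
    using su assms by (simp add: metric_diff_left su_diff ad_star_modes(2))
qed

text \<open>Metric compatibility, since inner products of left-invariant fields are constant. The
  Koszul formulas for \<open>A, B, C\<close> and \<open>A, C, B\<close> add up to 0.\<close>

lemma nabla_skew:
  assumes "A \<in> modes" "B \<in> modes" "C \<in> modes"
  shows "g (nabla N \<alpha> A B) C = - g B (nabla N \<alpha> A C)"
proof -
  note su = assms[THEN modes_su]
  have "2 * g (nabla N \<alpha> A B) C + 2 * g (nabla N \<alpha> A C) B = 0"
    using su metric_bracket_swap[OF su(2,3,1)]
    by (simp add: koszul assms metric_commute[of B "bracket \<alpha> A C"] metric_commute[of C "bracket \<alpha> A B"] su_bracket)
  then have "2 * (g (nabla N \<alpha> A B) C + g (nabla N \<alpha> A C) B) = 0"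
    by (simp only: distrib_left)
  then have "g (nabla N \<alpha> A B) C = - g (nabla N \<alpha> A C) B"
    by (simp add: eq_neg_iff_add_eq_0 del: distrib_left_numeral)
  also have "g (nabla N \<alpha> A C) B = g B (nabla N \<alpha> A C)"
    using assms by (intro metric_commute modes_su modes_nabla)
  finally show ?thesis .
qed

text \<open>Here \<open>E\<close> is the fixed direction and \<open>F\<close> the running basis
  vector. By \<open>nabla_skew\<close> the first curvature term pairs with the derivative of
  \<open>F\<close> along itself, which is 0, and the second becomes the product of two first
  derivatives. The Koszul formula for the bracket \<open>D\<close> resolves the third.\<close>

lemma curvature_term:
  assumes E: "E \<in> modes" and F: "F \<in> modes" and FF: "ad_star N \<alpha> F F = 0\<^sub>m N N"
  shows "g (riemann N \<alpha> F E E) F =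
      g (nabla N \<alpha> F E) (nabla N \<alpha> E F) + 1 / 2 * g (bracket \<alpha> F E) (bracket \<alpha> E F)
    + 1 / 2 * g (bracket \<alpha> F E) (ad_star N \<alpha> E F) - 1 / 2 * g (bracket \<alpha> F E) (ad_star N \<alpha> F E)"
proof -
  define D where "D = bracket \<alpha> F E"
  have D: "D \<in> modes" unfolding D_def using E F by (rule modes_bracket[rotated])
  note su = modes_su[OF E] modes_su[OF F] modes_su[OF D]
  note nm = modes_nabla[OF E E] modes_nabla[OF F E] modes_nabla[OF D E]
    modes_nabla[OF F modes_nabla[OF E E]] modes_nabla[OF E modes_nabla[OF F E]]
  have "bracket \<alpha> F F = 0\<^sub>m N N"
    using modes_carrier[OF F] by (auto simp: bracket_def commutator_def intro!: eq_matI)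
  then have "nabla N \<alpha> F F = 0\<^sub>m N N"
    by (simp add: nabla_def FF) (auto intro!: eq_matI)
  moreover have "g A (0\<^sub>m N N) = 0" if "A \<in> su N" for A
  proof -
    have "of_real 0 \<cdot>\<^sub>m E = 0\<^sub>m N N"
      using su_carrier[OF su(1)] by (auto intro!: eq_matI)
    then show ?thesis using metric_smult_right[OF su(1) that, of 0] by simp
  qed
  ultimately have t1: "g (nabla N \<alpha> F (nabla N \<alpha> E E)) F = 0"
    using nabla_skew[OF F nm(1) F] modes_su[OF nm(1)] by simp
  have t2: "g (nabla N \<alpha> E (nabla N \<alpha> F E)) F = - g (nabla N \<alpha> F E) (nabla N \<alpha> E F)"
    by (rule nabla_skew[OF E nm(2) F])
  have ad: "g B (bracket \<alpha> A C) = g C (ad_star N \<alpha> A B)"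
    if "A \<in> modes" "B \<in> modes" "C \<in> modes" for A B C
    using that ad_star_modes[OF that(1,2)] by (simp add: modes_su metric_commute[of C])
  have "g (bracket \<alpha> D E) F = - g D (ad_star N \<alpha> E F)"
    using metric_bracket_swap(1)[OF su(1,3,2)] ad[OF E F D]
    by (simp add: metric_commute[of _ F] su su_bracket)
  moreover have "g E (bracket \<alpha> D F) = - g D (ad_star N \<alpha> F E)"
    using metric_bracket_swap(2)[OF su(2,3,1)] ad[OF F E D] by simp
  ultimately have "2 * g (nabla N \<alpha> D E) F =
      - g D (ad_star N \<alpha> E F) + g D (ad_star N \<alpha> F E) - g D (bracket \<alpha> E F)"
    using koszul[OF D E F] by simp
  then have t3: "g (nabla N \<alpha> D E) F =
      (- g D (ad_star N \<alpha> E F) + g D (ad_star N \<alpha> F E) - g D (bracket \<alpha> E F)) / 2"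
    by (simp add: field_simps)
  have R: "g (riemann N \<alpha> F E E) F = g (nabla N \<alpha> F (nabla N \<alpha> E E)) F
     - g (nabla N \<alpha> E (nabla N \<alpha> F E)) F - g (nabla N \<alpha> D E) F"
    using nm[THEN modes_su] su by (simp add: riemann_def D_def[symmetric] metric_diff_left su_diff)
  show ?thesis
    unfolding R t1 t2 t3 D_def[symmetric] by (simp add: field_simps)
qed

text \<open>With \<open>D = P + Q\<close> and \<open>W\<close> its preimage under \<open>L\<close>,
  all terms are combinations of \<open>D\<close> and \<open>W\<close>. The coefficient -3 collects
  -1/4 from the connection term and -1/2 from the bracket term. The mixed products of
  \<open>D\<close> and \<open>W\<close> give the part \<open>4 * (lk + li)\<close>.\<close>

lemma curvature_term_value:
  fixes \<kappa> s \<mu> \<nu> lk li :: real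
  assumes E: "E \<in> modes" and F: "F \<in> modes" and P: "P \<in> modes" and Q: "Q \<in> modes"
    and LE: "L E = of_real lk \<cdot>\<^sub>m E" and LF: "L F = of_real li \<cdot>\<^sub>m F"
    and EF: "bracket \<alpha> E F = P + Q"
    and LP: "L P = of_real \<mu> \<cdot>\<^sub>m P" and LQ: "L Q = of_real \<nu> \<cdot>\<^sub>m Q"
    and nz: "\<mu> \<noteq> 0" "\<nu> \<noteq> 0"
    and PQ: "g P Q = 0" and PP: "g P P = of_real (s * \<mu>)" and QQ: "g Q Q = of_real (s * \<nu>)"
  shows "g (nabla N \<alpha> F E) (nabla N \<alpha> E F) + 1 / 2 * g (bracket \<alpha> F E) (bracket \<alpha> E F)
    + 1 / 2 * g (bracket \<alpha> F E) (ad_star N \<alpha> E F) - 1 / 2 * g (bracket \<alpha> F E) (ad_star N \<alpha> F E)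
    = of_real (s / 4 * (- 3 * (\<mu> + \<nu>) + (li - lk)\<^sup>2 * (inverse \<mu> + inverse \<nu>) + 4 * (lk + li)))"
proof -
  define D where "D = P + Q"
  define W where "W = of_real (inverse \<mu>) \<cdot>\<^sub>m P + of_real (inverse \<nu>) \<cdot>\<^sub>m Q"
  have D: "D \<in> su N" and W: "W \<in> su N"
    unfolding D_def W_def using P[THEN modes_su] Q[THEN modes_su] by (auto intro!: su_add su_smult simp del: of_real_inverse)
  have c: "E \<in> carrier_mat N N" "F \<in> carrier_mat N N" "P \<in> carrier_mat N N" "Q \<in> carrier_mat N N"
    "D \<in> carrier_mat N N" "W \<in> carrier_mat N N"
    using E F P Q D W by (auto simp: su_carrier)
  have LW: "L W = D"
    unfolding W_def D_def using c nz
    by (simp add: L_add L_smult LP LQ) (auto intro!: eq_matI simp flip: mult.assoc)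
  have br: "bracket \<alpha> F E = of_real (- 1) \<cdot>\<^sub>m D"
    using bracket_swap[OF c(1,2)] EF by (simp add: D_def)
  have sm: "bracket \<alpha> (of_real r \<cdot>\<^sub>m A) B = of_real r \<cdot>\<^sub>m bracket \<alpha> A B"
    if "A \<in> carrier_mat N N" "B \<in> carrier_mat N N" for r A B
    using that by (simp add: bracket_def commutator_smult_left[of _ N] ) (auto intro!: eq_matI)
  have "ad_star N \<alpha> E F = of_real (- li) \<cdot>\<^sub>m W"
    by (rule ad_star_eqI(1)[OF modes_su[OF E] modes_su[OF F] su_smult[OF W]])
      (simp add: L_smult c LW LF sm br, insert c, auto intro!: eq_matI)
  moreover have "ad_star N \<alpha> F E = of_real lk \<cdot>\<^sub>m W"
    by (rule ad_star_eqI(1)[OF modes_su[OF F] modes_su[OF E] su_smult[OF W]])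
      (simp add: L_smult c LW LE sm EF D_def)
  \<comment> \<open>Equal \<open>W\<close> parts and opposite \<open>D\<close> parts: in the product
    of the two derivatives the mixed terms cancel.\<close>
  moreover from calculation have
    "nabla N \<alpha> F E = of_real (- 1 / 2) \<cdot>\<^sub>m D + of_real ((li - lk) / 2) \<cdot>\<^sub>m W"
    "nabla N \<alpha> E F = of_real (1 / 2) \<cdot>\<^sub>m D + of_real ((li - lk) / 2) \<cdot>\<^sub>m W"
    unfolding nabla_def br EF D_def[symmetric] using c
    by (auto intro!: eq_matI simp: field_simps)
  \<comment> \<open>Inverting the Laplacian cancels the eigenvalue in \<open>s * \<mu>\<close> and
    \<open>s * \<nu>\<close>, so \<open>P\<close> and \<open>Q\<close> each contribute
    \<open>s\<close> to the mixed products.\<close>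
  moreover have "g D D = of_real (s * (\<mu> + \<nu>))" "g D W = of_real (2 * s)" "g W D = of_real (2 * s)"
    "g W W = of_real (s * (inverse \<mu> + inverse \<nu>))"
  proof -
    have su: "P \<in> su N" "Q \<in> su N" using P Q by (auto intro: modes_su)
    have "g Q P = 0" using PQ su by (simp add: metric_commute)
    note b = metric_add_left metric_add_right metric_smult_left metric_smult_right
      su su_add su_smult PQ PP QQ this
    show "g D D = of_real (s * (\<mu> + \<nu>))" unfolding D_def by
      (simp add: b algebra_simps del: of_real_mult of_real_add) (simp add: algebra_simps)
    show "g D W = of_real (2 * s)" unfolding D_def W_def using nz
      by (simp add: b del: of_real_inverse) (simp add: field_simps)
    then show "g W D = of_real (2 * s)" using metric_commute[OF D W] by simp
    show "g W W = of_real (s * (inverse \<mu> + inverse \<nu>))"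
      unfolding W_def using nz by (simp add: b del: of_real_inverse) (simp add: field_simps)
  qed
  ultimately show ?thesis
    unfolding br EF D_def[symmetric] using D W nz
    by (simp add: metric_add_left metric_add_right metric_smult_left metric_smult_right su_add su_smult
        del: of_real_divide of_real_minus of_real_diff)
      (simp add: field_simps power2_eq_square)
qed

section \<open>The metric on waves\<close>

definition metric_scale :: real where
  "metric_scale = - hbar N * N ^ 3 / (2 * pi\<^sup>2)"

lemma metric_scale_nz: "metric_scale \<noteq> 0"
  using hbar_pos by (simp add: metric_scale_def)

lemma trace_T_mult:
  "mat_trace (T N p * T N q) = cN * e (- cross p q) * mat_trace (T N (p + q))"
  by (simp add: T_mult mat_trace_smult[of _ N])

lemma trace_T_mult_minus: "mat_trace (T N p * T N (- p)) = - (of_nat N ^ 3 / (4 * of_real pi ^ 2))"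
proof -
  have "mat_trace (T N 0) = cN * of_nat N"
    unfolding T_0 by (simp add: mat_trace_def)
  moreover have "cN * cN = - (of_nat N ^ 2 / (4 * of_real pi ^ 2))"
    by (simp add: cN_def power_mult_distrib power_divide flip: power2_eq_square)
  ultimately show ?thesis
    by (simp add: trace_T_mult cross_def power2_eq_square power3_eq_cube flip: mult.assoc)
qed

lemma trace_wave_mult:
  "mat_trace (wave p x * wave q y) =
     x * y * mat_trace (T N p * T N q) + x * cnj y * mat_trace (T N p * T N (- q))
   + cnj x * y * mat_trace (T N (- p) * T N q) + cnj x * cnj y * mat_trace (T N (- p) * T N (- q))"
  unfolding wave_def by (simp add: mats mat_trace_add[of _ N] mat_trace_smult[of _ N] algebra_simps)

text \<open>All four products in the trace are multiples of T at plus or minus \<open>p + q\<close>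
  or \<open>p - q\<close>, and these matrices are traceless.\<close>

lemma metric_wave_orthogonal:
  assumes "\<not> zero_mod p" "\<not> zero_mod (p + q)" "\<not> zero_mod (p - q)"
  shows "g (wave p x) (wave q y) = 0"
proof -
  have "mat_trace (T N r * T N r') = 0" if "r + r' \<in> {p + q, p - q, - (p + q), - (p - q)}" for r r'
  proof -
    have "\<not> zero_mod (r + r')" using that assms zero_mod_minus by (metis insertE singletonD)
    then show ?thesis unfolding trace_T_mult by (simp add: T_trace)
  qed
  then show ?thesis
    using assms(1) by (simp add: metric_su wave_su L_wave trace_wave_mult)
qed

text \<open>The two square terms sit at plus or minus \<open>p + p\<close> and have trace 0. The two
  mixed terms each contribute the trace from \<open>trace_T_mult_minus\<close>; twice that value
  times \<open>hbar N\<close> is \<open>metric_scale\<close>.\<close>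

lemma metric_wave_self:
  assumes "\<not> zero_mod p"
  shows "g (wave p x) (wave p x) = of_real (metric_scale * (cmod x)\<^sup>2 * ev p)"
proof -
  have "mat_trace (T N p * T N p) = 0" "mat_trace (T N (- p) * T N (- p)) = 0"
    using assms zero_mod_double[of p] zero_mod_double[of "- p"] zero_mod_minus[of p]
    unfolding trace_T_mult by (simp_all add: T_trace del: fst_uminus snd_uminus fst_add snd_add)
  moreover have "cnj x * x = of_real ((cmod x)\<^sup>2)" "x * cnj x = of_real ((cmod x)\<^sup>2)"
    by (simp_all only: complex_norm_square mult.commute)
  ultimately show ?thesis
    using assms trace_T_mult_minus[of p] trace_T_mult_minus[of "- p"]
    by (simp add: metric_su wave_su L_wave trace_wave_mult metric_scale_def mult.assoc
        mult.left_commute[of x] mult.left_commute[of "cnj x"])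
qed

section \<open>Sums and differences of indices modulo \<open>N\<close>\<close>

lemma Z_index_small: "k \<in> Z_index N \<Longrightarrow> 2 * \<bar>fst k\<bar> < int N \<and> 2 * \<bar>snd k\<bar> < int N"
  using oddN by (auto simp: Z_index_def elim!: oddE)

lemma dvd_small: "int N dvd m \<Longrightarrow> \<bar>m\<bar> < int N \<Longrightarrow> m = 0"
  using dvd_imp_le_int[of m "int N"] by auto

lemma Z_plus_zero_mod: "k \<in> Z_plus N \<Longrightarrow> \<not> zero_mod k"
  using Z_index_small[of k] dvd_small[of "fst k"] dvd_small[of "snd k"]
  by (auto simp: Z_plus_def)

text \<open>The components of \<open>k + i\<close> are smaller than \<open>N\<close> in absolute
  value, so the sum could only vanish outright; but the half-plane \<open>Z_plus N\<close> contains
  no two opposite indices.\<close>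

lemma Z_plus_add_zero_mod:
  assumes "k \<in> Z_plus N" "i \<in> Z_plus N"
  shows "\<not> zero_mod (k + i)"
proof
  assume "zero_mod (k + i)"
  moreover have "k \<in> Z_index N" "i \<in> Z_index N"
    using assms by (auto simp: Z_plus_def)
  then have "\<bar>fst (k + i)\<bar> < int N" "\<bar>snd (k + i)\<bar> < int N"
    using Z_index_small[of k] Z_index_small[of i] by auto
  ultimately have "fst (k + i) = 0" "snd (k + i) = 0"
    using dvd_small by blast+
  then show False using assms by (auto simp: Z_plus_def)
qed

lemma Z_plus_diff_zero_mod:
  assumes "k \<in> Z_plus N" "i \<in> Z_plus N" "i \<noteq> k"
  shows "\<not> zero_mod (k - i)"
proof
  assume "zero_mod (k - i)"
  moreover have "k \<in> Z_index N" "i \<in> Z_index N"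
    using assms by (auto simp: Z_plus_def)
  then have "\<bar>fst (k - i)\<bar> < int N" "\<bar>snd (k - i)\<bar> < int N"
    using Z_index_small[of k] Z_index_small[of i] by auto
  ultimately have "fst (k - i) = 0" "snd (k - i) = 0"
    using dvd_small by blast+
  then show False using assms by (auto simp: prod_eq_iff)
qed

text \<open>A wave is an eigenvector of \<open>L\<close>, so it commutes with its image under
  \<open>L\<close>.\<close>

lemma ad_star_wave_self: "\<not> zero_mod p \<Longrightarrow> ad_star N \<alpha> (wave p x) (wave p x) = 0\<^sub>m N N"
proof (rule ad_star_eqI(1))
  have "0\<^sub>m N N = of_real 0 \<cdot>\<^sub>m wave p x"
    by (intro eq_matI) auto
  then have "L (0\<^sub>m N N) = of_real 0 \<cdot>\<^sub>m L (wave p x)"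
    by (simp only: L_smult wave_carrier)
  then show "L (0\<^sub>m N N) = bracket \<alpha> (L (wave p x)) (wave p x)"
    using su_carrier
    by (simp add: L_wave bracket_def flip: wave_smult)
      (simp add: commutator_smult_left[of _ N], auto simp: commutator_def intro!: eq_matI)
  show "\<not> zero_mod p \<Longrightarrow> 0\<^sub>m N N \<in> su N"
    using wave_su[of p 0] by (simp add: wave_zero)
qed (simp_all add: wave_su)

section \<open>One summand of the Ricci curvature, with \<open>E\<close> fixed and \<open>F\<close>
  running through the basis\<close>

definition ricci_summand :: "complex mat \<Rightarrow> complex mat \<Rightarrow> complex" where
  "ricci_summand E F =
     g (nabla N \<alpha> F E) (nabla N \<alpha> E F) / g F F
   + 1 / 2 * (g (bracket \<alpha> F E) (bracket \<alpha> E F) / g F F)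
   + 1 / 2 * (g (bracket \<alpha> F E) (ad_star N \<alpha> E F) / g F F)
   - 1 / 2 * (g (bracket \<alpha> F E) (ad_star N \<alpha> F E) / g F F)"

lemma ricci_summand_eq:
  "ricci_summand E F =
    (g (nabla N \<alpha> F E) (nabla N \<alpha> E F) + 1 / 2 * g (bracket \<alpha> F E) (bracket \<alpha> E F)
     + 1 / 2 * g (bracket \<alpha> F E) (ad_star N \<alpha> E F) - 1 / 2 * g (bracket \<alpha> F E) (ad_star N \<alpha> F E))
    / g F F"
  by (simp add: ricci_summand_def add_divide_distrib diff_divide_distrib)

lemma ricci_summand_curvature:
  assumes "\<not> zero_mod k" "\<not> zero_mod i"
  shows "g (riemann N \<alpha> (wave i y) (wave k x) (wave k x)) (wave i y) / g (wave i y) (wave i y)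
     = ricci_summand (wave k x) (wave i y)"
  using curvature_term[OF modes.wave modes.wave ad_star_wave_self] assms
  by (simp add: ricci_summand_eq)

lemma ricci_summand_wave:
  assumes k: "k \<in> Z_plus N" and i: "i \<in> Z_plus N" and x: "cmod x = 1 / 2" and y: "cmod y = 1 / 2"
  shows "ricci_summand (wave k x) (wave i y) = of_real (\<alpha>\<^sup>2 * (struct_const N i k)\<^sup>2 *
     ((- 3 * (ev (k + i) + ev (k - i)) + (ev i - ev k)\<^sup>2 * (inverse (ev (k + i)) + inverse (ev (k - i)))
       + 4 * (ev k + ev i)) / (16 * ev i)))"
proof -
  note nz = Z_plus_zero_mod[OF k] Z_plus_zero_mod[OF i] Z_plus_add_zero_mod[OF k i]
  define c where "c = struct_const N i k"
  define P where "P = wave (k + i) (of_real (\<alpha> * c) * (x * y))"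
  define Q where "Q = wave (k - i) (of_real (- \<alpha> * c) * (x * cnj y))"
  \<comment> \<open>The 16 comes from the squared modulus of \<open>x * y\<close>, which is
    1/16.\<close>
  define s where "s = metric_scale * (\<alpha>\<^sup>2 * c\<^sup>2) / 16"
  \<comment> \<open>For \<open>i = k\<close> both \<open>Q\<close> and \<open>s\<close> vanish, so any nonzero value may replace the eigenvalue \<open>0\<close> of \<open>Q\<close>.\<close>
  define \<nu> where "\<nu> = (if i = k then 1 else ev (k - i))"
  have c0: "c = 0" if "i = k"
    unfolding c_def by (rule struct_const_eq_0) (use that in auto)
  have modes: "wave k x \<in> modes" "wave i y \<in> modes" "P \<in> modes"
    using nz unfolding P_def by (auto intro: modes.wave simp del: fst_add snd_add)
  have Lw: "L (wave p z) = of_real (ev p) \<cdot>\<^sub>m wave p z" for p z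
    by (simp add: L_wave wave_smult)
  have br: "bracket \<alpha> (wave k x) (wave i y) = P + Q"
    unfolding bracket_wave P_def Q_def c_def by simp
  have PP: "g P P = of_real (s * ev (k + i))"
    unfolding P_def using nz by (simp add: metric_wave_self norm_mult x y s_def power_mult_distrib power_divide)
  have Q: "Q \<in> modes" "L Q = of_real \<nu> \<cdot>\<^sub>m Q" "g P Q = 0" "g Q Q = of_real (s * \<nu>)"
  proof -
    have "Q \<in> modes \<and> L Q = of_real \<nu> \<cdot>\<^sub>m Q \<and> g P Q = 0 \<and> g Q Q = of_real (s * \<nu>)"
    proof (cases "i = k")
      case True
      then have "Q = wave k 0" "P = wave k 0" by (simp_all add: Q_def P_def c0 wave_zero)
      then show ?thesis
        using True nz(1) by (simp add: wave_0_modes L_wave wave_smult metric_wave_self s_def c0)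
    next
      case False
      have "\<not> zero_mod (k - i)" using Z_plus_diff_zero_mod[OF k i False] .
      \<comment> \<open>For the orthogonality of \<open>P\<close> and \<open>Q\<close>, the sum and
        difference of their indices must be nonzero modulo \<open>N\<close>; they are doubles of
        \<open>k\<close> and \<open>i\<close>.\<close>
      moreover have "(k + i) + (k - i) = k + k" "(k + i) - (k - i) = i + i"
        by (simp_all add: prod_eq_iff)
      then have "\<not> zero_mod ((k + i) + (k - i))" "\<not> zero_mod ((k + i) - (k - i))"
        using nz zero_mod_double by metis+
      ultimately show ?thesis
        using nz False unfolding P_def Q_def
        by (simp add: modes.wave Lw metric_wave_orthogonal metric_wave_self norm_mult x y s_def \<nu>_def
            power_mult_distrib power_divide del: fst_add snd_add fst_diff snd_diff)
    qed
    then show "Q \<in> modes" "L Q = of_real \<nu> \<cdot>\<^sub>m Q" "g P Q = 0" "g Q Q = of_real (s * \<nu>)"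
      by auto
  qed
  have "ev (k + i) \<noteq> 0" "ev i \<noteq> 0"
    using nz eigval_eq_0_iff by blast+
  moreover have "\<nu> \<noteq> 0"
    using Z_plus_diff_zero_mod[OF k i] eigval_eq_0_iff[of "k - i"] by (simp add: \<nu>_def)
  ultimately have "ricci_summand (wave k x) (wave i y) = of_real (s / 4 * (- 3 * (ev (k + i) + \<nu>)
      + (ev i - ev k)\<^sup>2 * (inverse (ev (k + i)) + inverse \<nu>) + 4 * (ev k + ev i))) / g (wave i y) (wave i y)"
    unfolding ricci_summand_eq
    by (subst curvature_term_value[OF modes(1,2,3) Q(1) Lw Lw br _ Q(2) _ _ Q(3) PP Q(4)])
      (simp_all only: P_def Lw not_False_eq_True)
  also have "g (wave i y) (wave i y) = of_real (metric_scale / 4 * ev i)"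
    using nz by (simp add: metric_wave_self y power_divide)
  \<comment> \<open>For \<open>i = k\<close> both sides are 0 because \<open>s\<close> is, so the
    substitute \<open>\<nu>\<close> can be exchanged for the eigenvalue at
    \<open>k - i\<close>.\<close>
  also have "s / 4 * (- 3 * (ev (k + i) + \<nu>)
      + (ev i - ev k)\<^sup>2 * (inverse (ev (k + i)) + inverse \<nu>) + 4 * (ev k + ev i))
    = s / 4 * (- 3 * (ev (k + i) + ev (k - i))
      + (ev i - ev k)\<^sup>2 * (inverse (ev (k + i)) + inverse (ev (k - i))) + 4 * (ev k + ev i))"
    by (cases "i = k") (simp_all add: \<nu>_def s_def c0)
  finally have "ricci_summand (wave k x) (wave i y) = of_real (s / 4 * (- 3 * (ev (k + i) + ev (k - i))
      + (ev i - ev k)\<^sup>2 * (inverse (ev (k + i)) + inverse (ev (k - i))) + 4 * (ev k + ev i))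
      / (metric_scale / 4 * ev i))"
    by (simp only: of_real_divide)
  moreover have "s / 4 * z / (metric_scale / 4 * ev i) = \<alpha>\<^sup>2 * c\<^sup>2 * (z / (16 * ev i))" for z
    using \<open>ev i \<noteq> 0\<close> metric_scale_nz by (simp add: s_def)
  ultimately show ?thesis by (simp only: c_def)
qed

end

theorem proposition6p1:
  fixes N :: nat and \<alpha> :: real and k :: "int \<times> int" and E :: "complex mat"
  assumes "N \<ge> 3" and "odd N" and "\<alpha> > 0"
    and "k \<in> Z_plus N" and "E \<in> {X N k, Y N k}"
  shows "let S = basis_sum N (\<lambda>Ei.
             metric N \<alpha> (nabla N \<alpha> Ei E) (nabla N \<alpha> E Ei) / metric N \<alpha> Ei Ei
           + 1 / 2 * (metric N \<alpha> (bracket \<alpha> Ei E) (bracket \<alpha> E Ei) / metric N \<alpha> Ei Ei)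
           + 1 / 2 * (metric N \<alpha> (bracket \<alpha> Ei E) (ad_star N \<alpha> E Ei) / metric N \<alpha> Ei Ei)
           - 1 / 2 * (metric N \<alpha> (bracket \<alpha> Ei E) (ad_star N \<alpha> Ei E) / metric N \<alpha> Ei Ei))
    in (of_nat N ^ 2 - 1) * ricci N \<alpha> E E = S
     \<and> S = complex_of_real (\<alpha>\<^sup>2 * (\<Sum>i\<in>Z_plus N. (struct_const N i k)\<^sup>2 *
           ((- 3 * (eigval N \<alpha> (k + i) + eigval N \<alpha> (k - i))
             + (eigval N \<alpha> i - eigval N \<alpha> k)\<^sup>2
                 * (inverse (eigval N \<alpha> (k + i)) + inverse (eigval N \<alpha> (k - i)))
             + 4 * (eigval N \<alpha> k + eigval N \<alpha> i))
            / (8 * eigval N \<alpha> i))))"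
proof -
  interpret zeitlin N \<alpha>
    using assms(1-3) by unfold_locales
  obtain x where E: "E = wave k x" and x: "cmod x = 1 / 2"
    using assms(5) by (auto simp: X_eq_wave Y_eq_wave norm_divide norm_mult)
  have nz: "\<not> zero_mod k" using assms(4) by (rule Z_plus_zero_mod)
  \<comment> \<open>The normalizing factor in \<open>ricci\<close> has to be nonzero in order to
    cancel.\<close>
  have "of_nat (N\<^sup>2) \<noteq> (of_nat 1 :: complex)"
    using assms(1) by (subst of_nat_eq_iff) simp
  then have N: "(of_nat N ^ 2 - 1 :: complex) \<noteq> 0"
    by simp
  have "basis_sum N (\<lambda>F. g (riemann N \<alpha> F E E) F / g F F) = basis_sum N (ricci_summand E)"
    unfolding basis_sum_def X_eq_wave Y_eq_wave E
    by (intro sum.cong refl arg_cong2[where f = "(+)"] ricci_summand_curvature nz Z_plus_zero_mod)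
  then have 1: "(of_nat N ^ 2 - 1) * ricci N \<alpha> E E = basis_sum N (ricci_summand E)"
    using N by (simp add: ricci_def)
  define t where "t i = \<alpha>\<^sup>2 * (struct_const N i k)\<^sup>2 *
     ((- 3 * (ev (k + i) + ev (k - i)) + (ev i - ev k)\<^sup>2 * (inverse (ev (k + i)) + inverse (ev (k - i)))
       + 4 * (ev k + ev i)) / (16 * ev i))" for i
  have "ricci_summand E (wave i y) = of_real (t i)" if "i \<in> Z_plus N" "cmod y = 1 / 2" for i y
    unfolding t_def E using assms(4) that x by (intro ricci_summand_wave)
  \<comment> \<open>The value \<open>t i\<close> depends on the running wave only through its index,
    as both coefficients have modulus 1/2. The resulting doubling turns the denominator 16 into
    8.\<close>
  then have "basis_sum N (ricci_summand E) = (\<Sum>i\<in>Z_plus N. of_real (t i) + of_real (t i))"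
    unfolding basis_sum_def X_eq_wave Y_eq_wave by (intro sum.cong refl) (simp add: norm_divide norm_mult)
  also have "\<dots> = of_real (\<Sum>i\<in>Z_plus N. 2 * t i)"
    by simp
  also have "(\<Sum>i\<in>Z_plus N. 2 * t i) = \<alpha>\<^sup>2 * (\<Sum>i\<in>Z_plus N. (struct_const N i k)\<^sup>2 *
           ((- 3 * (ev (k + i) + ev (k - i))
             + (ev i - ev k)\<^sup>2 * (inverse (ev (k + i)) + inverse (ev (k - i)))
             + 4 * (ev k + ev i)) / (8 * ev i)))"
    unfolding t_def sum_distrib_left by (intro sum.cong refl) simp
  finally show ?thesis
    using 1 unfolding Let_def ricci_summand_def by blast
qed

end
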